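(* For each $\chi \in \widehat{\mathcal{O}^{\times}}$ and $m \geq c(\chi)$, there exists a unique locally constant function $P_{\chi,m}^{\circ}$ in $\mathcal{H}_{\chi,m}(S^{n-1})$ satisfying $P_{\chi,m}^{\circ}(xk') = P_{\chi,m}^{\circ}(x)$ for all $x \in S^{n-1}$ and $k' \in K_{n-1,1}$ and $P_{\chi,m}^{\circ}(e_n) = 1$. This function is given by \[P_{\chi,m}^{\circ}(x_1,\ldots,x_n) = \begin{cases} \chi(x_n) & \text{if } \max\{|x_1|,\ldots,|x_{n-1}|\} \leq q^{-m}, \\ \alpha_{\chi,m;m-1}\,\chi(x_n) & \text{if } m > c(\chi) \text{ and } \max\{|x_1|,\ldots,|x_{n-1}|\} = q^{-m+1}, \\ 0 & \text{otherwise,}\end{cases}\] where \[\alpha_{\chi,m;m-1} = \begin{cases} -\dfrac{q-1}{q(q^{n-1}-1)} & \text{if } m = 1, \\ -\dfrac{1}{q^{n-1}-1} & \text{if } m \geq 2.\end{cases}\] In particular, for all $k \in K$, we have that $P_{\chi,m}^{\circ}(e_n k) = \overline{P_{\chi,m}^{\circ}(e_n k^{-1})}$.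
   Context: Let $F$ be a nonarchimedean local field with ring of integers $\mathcal{O}$, maximal ideal $\mathfrak{p}$, uniformiser $\varpi$, residue field of order $q$, and absolute value normalised by $|\varpi| = q^{-1}$. Fix $n \geq 2$ and let $K = \mathrm{GL}_n(\mathcal{O})$ with Haar probability measure $dk$. Let \[K_{n-1,1} = \left\{\begin{pmatrix} a & b \\ 0 & 1\end{pmatrix} \in K : a \in \mathrm{GL}_{n-1}(\mathcal{O}),\ b \in \mathrm{Mat}_{(n-1)\times 1}(\mathcal{O})\right\}.\] Let $S^{n-1} = \{x \in F^n : \max\{|x_1|,\ldots,|x_n|\} = 1\}$ (row vectors), on which $K$ acts by $k \cdot x = xk$, and let $e_n = (0,\ldots,0,1)$. $C^{\infty}(S^{n-1})$ is the space of locally constant functions $f : S^{n-1} \to \mathbb{C}$, with inner product $\langle f_1,f_2\rangle = \int_K f_1(e_n k)\overline{f_2(e_n k)}\,dk$. For $m \geq 0$, $K(\mathfrak{p}^m) = \{k \in K : k - 1_n \in \mathrm{Mat}_{n\times n}(\mathfrak{p}^m)\}$. $\widehat{\mathcal{O}^{\times}}$ is the set of continuous characters $\chi : \mathcal{O}^{\times} \to \mathbb{C}^{\times}$. The conductor exponent $c(\chi)$ is the least nonnegative integer $m$ such that $\chi$ is trivial on $1+\mathfrak{p}^m$ (on $\mathcal{O}^{\times}$ if $m=0$). Let $C^{\infty}(S^{n-1})_{\chi}^{K(\mathfrak{p}^m)}$ be the space of $f \in C^{\infty}(S^{n-1})$ with $f(xk) = f(x)$ for all $k \in K(\mathfrak{p}^m)$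 and $f(ax) = \chi(a) f(x)$ for all $a \in \mathcal{O}^{\times}$. For $m \geq c(\chi)$, $\mathcal{H}_{\chi,m}(S^{n-1})$ is $C^{\infty}(S^{n-1})_{\chi}^{K(\mathfrak{p}^{c(\chi)})}$ if $m = c(\chi)$, and the orthogonal complement of $C^{\infty}(S^{n-1})_{\chi}^{K(\mathfrak{p}^{m-1})}$ in $C^{\infty}(S^{n-1})_{\chi}^{K(\mathfrak{p}^m)}$ if $m > c(\chi)$. Convention: if $\chi$ is trivial, $\chi(y)$ is read as $1$ for every $y \in \mathcal{O}$, including non-units. (When $\chi$ is nontrivial, $\chi$ is only evaluated at units in the formula.) *)

theory Defs
  imports "HOL-Analysis.Analysis" "HOL-Library.FuncSet" "HOL-Algebra.Group"
    "Jordan_Normal_Form.Matrix"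
begin

text \<open>Vectors and matrices are those of \<^theory>\<open>Jordan_Normal_Form.Matrix\<close>, indexed from 0: the
  coordinates $x_1, \ldots, x_n$ are \<open>x $ 0\<close>, ..., \<open>x $ (n - 1)\<close>. Everything
  depends on an absolute value \<open>v\<close> on a field, and powers of the maximal ideal also on a
  uniformiser \<open>w\<close>.\<close>

no_notation Finite_Cartesian_Product.vec_nth (infixl \<open>$\<close> 90)
hide_const (open) Finite_Cartesian_Product.vec Finite_Cartesian_Product.mat

subsection \<open>Nonarchimedean local fields\<close>

definition integers :: "('a::field \<Rightarrow> real) \<Rightarrow> 'a set" where
  "integers v = {x. v x \<le> 1}"

definition max_ideal :: "('a::field \<Rightarrow> real) \<Rightarrow> 'a set" where
  "max_ideal v = {x. v x < 1}"

definition integer_units :: "('a::field \<Rightarrow> real) \<Rightarrow> 'a set" where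
  "integer_units v = {x \<in> integers v. \<exists>y \<in> integers v. x * y = 1}"

definition residue_field :: "('a::field \<Rightarrow> real) \<Rightarrow> 'a set set" where
  "residue_field v =
     integers v // {(x, y). x \<in> integers v \<and> y \<in> integers v \<and> x - y \<in> max_ideal v}"

definition residue_order :: "('a::field \<Rightarrow> real) \<Rightarrow> nat" where
  "residue_order v = card (residue_field v)"

definition ideal_power :: "('a::field \<Rightarrow> real) \<Rightarrow> 'a \<Rightarrow> nat \<Rightarrow> 'a set" where
  "ideal_power v w m = (\<lambda>y. w ^ m * y) ` integers v"

definition field_dist :: "('a::field \<Rightarrow> real) \<Rightarrow> 'a \<Rightarrow> 'a \<Rightarrow> real" where
  "field_dist v x y = v (x - y)"

locale nonarch_abs =
  fixes v :: "'a::field \<Rightarrow> real"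
  assumes nonneg: "0 \<le> v x"
    and eq_zero_iff: "v x = 0 \<longleftrightarrow> x = 0"
    and mult: "v (x * y) = v x * v y"
    and ultrametric: "v (x + y) \<le> max (v x) (v y)"

locale nonarch_local_field = nonarch_abs v for v :: "'a::field \<Rightarrow> real" +
  fixes w :: 'a
  assumes complete: "Metric_space.mcomplete UNIV (field_dist v)"
    and uniformiser: "max_ideal v = (\<lambda>y. w * y) ` integers v"
    and finite_residue_field: "finite (residue_field v)"
    and abs_uniformiser: "v w = 1 / real (residue_order v)"

subsection \<open>Topologies\<close>

definition vec_dist :: "('a::field \<Rightarrow> real) \<Rightarrow> nat \<Rightarrow> 'a vec \<Rightarrow> 'a vec \<Rightarrow> real" where
  "vec_dist v n x y = Max ((\<lambda>i. v (x $ i - y $ i)) ` {..<n})"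

definition mat_dist :: "('a::field \<Rightarrow> real) \<Rightarrow> nat \<Rightarrow> 'a mat \<Rightarrow> 'a mat \<Rightarrow> real" where
  "mat_dist v n A B = Max ((\<lambda>(i, j). v (A $$ (i, j) - B $$ (i, j))) ` ({..<n} \<times> {..<n}))"

definition field_topology :: "('a::field \<Rightarrow> real) \<Rightarrow> 'a topology" where
  "field_topology v = Metric_space.mtopology UNIV (field_dist v)"

definition vec_topology :: "('a::field \<Rightarrow> real) \<Rightarrow> nat \<Rightarrow> 'a vec topology" where
  "vec_topology v n = Metric_space.mtopology (carrier_vec n) (vec_dist v n)"

definition mat_topology :: "('a::field \<Rightarrow> real) \<Rightarrow> nat \<Rightarrow> 'a mat topology" where
  "mat_topology v n = Metric_space.mtopology (carrier_mat n n) (mat_dist v n)"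

subsection \<open>The group \<open>GL\<^sub>n(O)\<close> and its subgroups\<close>

definition mat_monoid :: "('a::field \<Rightarrow> real) \<Rightarrow> nat \<Rightarrow> 'a mat monoid" where
  "mat_monoid v n =
     \<lparr>carrier = {A \<in> carrier_mat n n. elements_mat A \<subseteq> integers v}, monoid.mult = (*), one = 1\<^sub>m n\<rparr>"

definition GL :: "('a::field \<Rightarrow> real) \<Rightarrow> nat \<Rightarrow> 'a mat set" where
  "GL v n = Units (mat_monoid v n)"

definition congruence_subgroup :: "('a::field \<Rightarrow> real) \<Rightarrow> 'a \<Rightarrow> nat \<Rightarrow> nat \<Rightarrow> 'a mat set" where
  "congruence_subgroup v w n m = {k \<in> GL v n. elements_mat (k - 1\<^sub>m n) \<subseteq> ideal_power v w m}"

definition mirabolic :: "('a::field \<Rightarrow> real) \<Rightarrow> nat \<Rightarrow> 'a mat set" where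
  "mirabolic v n = {k \<in> GL v n. \<exists>a b. a \<in> GL v (n - 1) \<and>
     b \<in> carrier_mat (n - 1) 1 \<and> elements_mat b \<subseteq> integers v \<and>
     k = four_block_mat a b (0\<^sub>m 1 (n - 1)) (1\<^sub>m 1)}"

text \<open>A left-invariant Borel probability measure; on a compact metrisable group regularity is
  automatic, so this determines the Haar probability measure.\<close>

definition haar_probability :: "('a::field \<Rightarrow> real) \<Rightarrow> nat \<Rightarrow> 'a mat measure \<Rightarrow> bool" where
  "haar_probability v n \<mu> \<longleftrightarrow>
     space \<mu> = GL v n \<and>
     sets \<mu> = sigma_sets (GL v n) {U. openin (subtopology (mat_topology v n) (GL v n)) U} \<and>
     emeasure \<mu> (GL v n) = 1 \<and>
     (\<forall>k \<in> GL v n. \<forall>A \<in> sets \<mu>. emeasure \<mu> ((\<lambda>x. k * x) ` A) = emeasure \<mu> A)"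

subsection \<open>Functions on the unit sphere\<close>

definition row_mult :: "'a::field vec \<Rightarrow> 'a mat \<Rightarrow> 'a vec"  (infixl \<open>\<bullet>\<^sub>r\<close> 70) where
  "x \<bullet>\<^sub>r A = vec (dim_col A) (\<lambda>j. x \<bullet> col A j)"

definition unit_sphere :: "('a::field \<Rightarrow> real) \<Rightarrow> nat \<Rightarrow> 'a vec set" where
  "unit_sphere v n = {x \<in> carrier_vec n. Max ((\<lambda>i. v (x $ i)) ` {..<n}) = 1}"

definition e_last :: "nat \<Rightarrow> 'a::field vec" where
  "e_last n = unit_vec n (n - 1)"

text \<open>A function on the sphere is represented by a function on all vectors that is
  \<^const>\<open>undefined\<close> off the sphere, so that equality is equality of functions on the sphere.\<close>

definition loc_const :: "('a::field \<Rightarrow> real) \<Rightarrow> nat \<Rightarrow> ('a vec \<Rightarrow> complex) set" where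
  "loc_const v n = {f \<in> extensional (unit_sphere v n).
     \<forall>x \<in> unit_sphere v n. \<exists>U. openin (subtopology (vec_topology v n) (unit_sphere v n)) U \<and>
       x \<in> U \<and> (\<forall>y \<in> U. f y = f x)}"

definition sphere_inner ::
  "nat \<Rightarrow> 'a::field mat measure \<Rightarrow> ('a vec \<Rightarrow> complex) \<Rightarrow> ('a vec \<Rightarrow> complex) \<Rightarrow> complex" where
  "sphere_inner n \<mu> f g = (\<integral>k. f (e_last n \<bullet>\<^sub>r k) * cnj (g (e_last n \<bullet>\<^sub>r k)) \<partial>\<mu>)"

text \<open>Only the restriction of \<open>chi\<close> to the units matters.\<close>

definition unit_character :: "('a::field \<Rightarrow> real) \<Rightarrow> ('a \<Rightarrow> complex) \<Rightarrow> bool" where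
  "unit_character v chi \<longleftrightarrow>
     (\<forall>x \<in> integer_units v. \<forall>y \<in> integer_units v. chi (x * y) = chi x * chi y) \<and>
     continuous_map (subtopology (field_topology v) (integer_units v)) (top_of_set (- {0})) chi"

definition unit_filtration :: "('a::field \<Rightarrow> real) \<Rightarrow> 'a \<Rightarrow> nat \<Rightarrow> 'a set" where
  "unit_filtration v w m =
     (if m = 0 then integer_units v else (\<lambda>y. 1 + y) ` ideal_power v w m)"

definition conductor :: "('a::field \<Rightarrow> real) \<Rightarrow> 'a \<Rightarrow> ('a \<Rightarrow> complex) \<Rightarrow> nat" where
  "conductor v w chi = (LEAST m. \<forall>u \<in> unit_filtration v w m. chi u = 1)"

definition level_space ::
  "('a::field \<Rightarrow> real) \<Rightarrow> 'a \<Rightarrow> nat \<Rightarrow> ('a \<Rightarrow> complex) \<Rightarrow> nat \<Rightarrow> ('a vec \<Rightarrow> complex) set" where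
  "level_space v w n chi m = {f \<in> loc_const v n.
     (\<forall>k \<in> congruence_subgroup v w n m. \<forall>x \<in> unit_sphere v n. f (x \<bullet>\<^sub>r k) = f x) \<and>
     (\<forall>a \<in> integer_units v. \<forall>x \<in> unit_sphere v n. f (a \<cdot>\<^sub>v x) = chi a * f x)}"

text \<open>Meaningful only for \<open>m \<ge> conductor v w chi\<close>.\<close>

definition harmonic_space ::
  "('a::field \<Rightarrow> real) \<Rightarrow> 'a \<Rightarrow> nat \<Rightarrow> 'a mat measure \<Rightarrow> ('a \<Rightarrow> complex) \<Rightarrow> nat
    \<Rightarrow> ('a vec \<Rightarrow> complex) set" where
  "harmonic_space v w n \<mu> chi m =
     (if m = conductor v w chi then level_space v w n chi m
      else {f \<in> level_space v w n chi m.
              \<forall>g \<in> level_space v w n chi (m - 1). sphere_inner n \<mu> f g = 0})"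

definition zonal ::
  "('a::field \<Rightarrow> real) \<Rightarrow> 'a \<Rightarrow> nat \<Rightarrow> 'a mat measure \<Rightarrow> ('a \<Rightarrow> complex) \<Rightarrow> nat
    \<Rightarrow> ('a vec \<Rightarrow> complex) \<Rightarrow> bool" where
  "zonal v w n \<mu> chi m P \<longleftrightarrow> P \<in> harmonic_space v w n \<mu> chi m \<and>
     (\<forall>x \<in> unit_sphere v n. \<forall>k \<in> mirabolic v n. P (x \<bullet>\<^sub>r k) = P x) \<and>
     P (e_last n) = 1"

text \<open>The trivial character is read as 1 on non-units as well.\<close>

definition char_value :: "('a::field \<Rightarrow> real) \<Rightarrow> ('a \<Rightarrow> complex) \<Rightarrow> 'a \<Rightarrow> complex" where
  "char_value v chi y = (if \<forall>u \<in> integer_units v. chi u = 1 then 1 else chi y)"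

definition zonal_coeff :: "nat \<Rightarrow> nat \<Rightarrow> nat \<Rightarrow> real" where
  "zonal_coeff q n m =
     (if m = 1 then - ((real q - 1) / (real q * (real q ^ (n - 1) - 1)))
      else - (1 / (real q ^ (n - 1) - 1)))"

subsection \<open>The distances are metrics\<close>

context nonarch_abs
begin

lemma abs_zero [simp]: "v 0 = 0"
  by (simp add: eq_zero_iff)

lemma abs_one: "v 1 = 1"
  using mult[of 1 1] eq_zero_iff[of 1] by auto

lemma abs_minus: "v (- x) = v x"
proof -
  have "v (- 1) * v (- 1) = 1"
    using mult[of "- 1" "- 1"] abs_one by simp
  then have "v (- 1) = 1"
    using nonneg[of "- 1"] by (metis abs_of_nonneg abs_mult_self_eq real_sqrt_abs2 real_sqrt_one)
  then show ?thesis
    using mult[of "- 1" x] by simp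
qed

lemma abs_diff_commute: "v (x - y) = v (y - x)"
  using abs_minus[of "x - y"] by simp

lemma abs_diff_triangle: "v (x - z) \<le> v (x - y) + v (y - z)"
  using ultrametric[of "x - y" "y - z"] nonneg[of "x - y"] nonneg[of "y - z"] by simp

lemma Metric_space_field: "Metric_space UNIV (field_dist v)"
  by unfold_locales
    (auto simp: field_dist_def nonneg abs_diff_commute eq_zero_iff abs_diff_triangle)

lemma Metric_space_Max:
  assumes fin: "finite I" "I \<noteq> {}"
    and ext: "\<And>x y. \<lbrakk>x \<in> M; y \<in> M; \<And>i. i \<in> I \<Longrightarrow> c x i = c y i\<rbrakk> \<Longrightarrow> x = y"
    and d: "\<And>x y. d x y = Max ((\<lambda>i. v (c x i - c y i)) ` I)"
  shows "Metric_space M d"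
proof
  have le: "d x y \<le> r \<longleftrightarrow> (\<forall>i\<in>I. v (c x i - c y i) \<le> r)" for x y r
    using fin by (auto simp: d)
  have pos: "0 \<le> d x y" for x y
    using le[of x y "d x y"] fin nonneg by (meson all_not_in_conv order_trans order_refl)
  fix x y z
  show "0 \<le> d x y" by (fact pos)
  show "d x y = d y x"
    by (simp add: d abs_diff_commute)
  assume "x \<in> M" "y \<in> M"
  have "d x y = 0 \<longleftrightarrow> (\<forall>i\<in>I. v (c x i - c y i) \<le> 0)"
    using le[of x y 0] pos[of x y] by auto
  also have "\<dots> \<longleftrightarrow> (\<forall>i\<in>I. c x i = c y i)"
    using nonneg eq_zero_iff by (metis eq_iff right_minus_eq)
  also have "\<dots> \<longleftrightarrow> x = y"
    using ext[OF \<open>x \<in> M\<close> \<open>y \<in> M\<close>] by auto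
  finally show "(d x y = 0) = (x = y)" .
  have "\<forall>i\<in>I. v (c x i - c z i) \<le> d x y + d y z"
    using le[of x y "d x y"] le[of y z "d y z"] abs_diff_triangle
    by (meson add_mono order_refl order_trans)
  then show "d x z \<le> d x y + d y z"
    using le by blast
qed

lemma Metric_space_vec: "n > 0 \<Longrightarrow> Metric_space (carrier_vec n) (vec_dist v n)"
  by (rule Metric_space_Max[where I = "{..<n}" and c = "\<lambda>x i. x $ i"])
    (auto simp: vec_dist_def)

lemma Metric_space_mat: "n > 0 \<Longrightarrow> Metric_space (carrier_mat n n) (mat_dist v n)"
  by (rule Metric_space_Max[where I = "{..<n} \<times> {..<n}" and c = "\<lambda>A ij. A $$ ij"])
    (auto simp: mat_dist_def case_prod_unfold)

end

end

theory Submission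
  imports Defs
begin

text \<open>An integral rank one perturbation $1 + c u^T$ of the identity lies in \<open>GL\<^sub>n(O)\<close> as soon as
  $1 + u^T c$ is a unit, and it moves the row vector $x$ to $x + (x c) u^T$. For suitable $c$ and
  $u$ a single such matrix carries a given point of the sphere to another. Thus the orbits of the
  congruence subgroup of level $m$ are the congruence classes modulo the $m$-th power of the maximal
  ideal, and the mirabolic subgroup identifies two points with the same value $M > 0$ of
  $\max(|x_1|, \ldots, |x_{n-1}|)$ whose last coordinates differ by at most $M$.

  Hence a zonal function $P$ of level $m$ equals $\chi(x_n)$ where $M \leq q^{-m}$ and
  $a \chi(x_n)$ where $M = q^{1-m}$, for some constant $a$. If $m > c(\chi)$, the cutoff of $P$ to
  $M > q^{1-m}$ has level $m - 1$, so orthogonality makes it vanish, and orthogonality to the cutoff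
  of $\chi(x_n)$ to $M \leq q^{1-m}$ determines $a$ from the volumes of these sets. Conversely,
  every function of level $m - 1$ is a multiple of $\chi(x_n)$ where $M \leq q^{1-m}$, so that one
  relation gives orthogonality to all of them. If $m = c(\chi)$, equivariance under a unit congruent
  to $1$ modulo the $(m-1)$-st power with $\chi \neq 1$ forces $P = 0$ where $M > q^{-m}$.\<close>

text \<open>Let V_j be the measure of the set M <= q^(-j) in the sphere. The relation fixing the
  constant is V_m + a (V_(m-1) - V_m) = 0, and the two cases of \<open>zonal_coeff\<close> come from
  two regimes of V_j. For j >= 1 the last coordinate is a unit, the ratios x_i / x_n vary freely at
  scale q^(-j), and V_j = q^(n-1) V_(j+1). For j = 0 it may be a non-unit; here V_0 = 1, and V_1 =
  (q-1)/(q^n-1) is found by counting nonzero vectors over the residue field.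

  Three facts have to be supplied. The measure is only assumed left invariant, whereas moving
  subsets of the sphere translates their preimages on the right. Characters take values in the
  nonzero complex numbers, so the existence of a conductor has to be derived from continuity, and
  absolute value 1 from the finiteness of residue rings. The final identity compares the last rows x
  of k and y of its inverse: they have the same M, and x_n y_n is within M of 1.\<close>

definition sup_abs :: "('a::field \<Rightarrow> real) \<Rightarrow> nat \<Rightarrow> 'a vec \<Rightarrow> real" where
  "sup_abs v N x = Max ((\<lambda>i. v (x $ i)) ` {..<N})"

definition rank_one :: "nat \<Rightarrow> 'a::field vec \<Rightarrow> 'a vec \<Rightarrow> 'a mat" where
  "rank_one n c u = mat n n (\<lambda>(i, j). (if i = j then 1 else 0) + c $ i * u $ j)"

subsection \<open>Row vectors and integral matrices\<close>

lemma row_mult_carrier [simp]: "A \<in> carrier_mat n k \<Longrightarrow> x \<bullet>\<^sub>r A \<in> carrier_vec k"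
  by (simp add: row_mult_def)

lemma dim_row_mult [simp]: "dim_vec (x \<bullet>\<^sub>r A) = dim_col A"
  by (simp add: row_mult_def)

lemma row_mult_eq_transpose:
  fixes A :: "'a::field mat"
  assumes "A \<in> carrier_mat n k" "x \<in> carrier_vec n"
  shows "x \<bullet>\<^sub>r A = A\<^sup>T *\<^sub>v x"
  using assms by (intro eq_vecI) (auto simp: row_mult_def intro!: comm_scalar_prod)

lemma row_mult_assoc:
  fixes A B :: "'a::field mat"
  assumes "A \<in> carrier_mat n k" "B \<in> carrier_mat k l" "x \<in> carrier_vec n"
  shows "x \<bullet>\<^sub>r (A * B) = x \<bullet>\<^sub>r A \<bullet>\<^sub>r B"
proof -
  have "A * B \<in> carrier_mat n l" "x \<bullet>\<^sub>r A \<in> carrier_vec k"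
    using assms by auto
  then show ?thesis
    using assms row_mult_eq_transpose[of "A * B" n l x] row_mult_eq_transpose[of A n k x]
      row_mult_eq_transpose[of B k l "x \<bullet>\<^sub>r A"]
    by (simp add: transpose_mult[OF assms(1,2)] assoc_mult_mat_vec[of _ l k _ n])
qed

lemma row_mult_one [simp]: "x \<in> carrier_vec n \<Longrightarrow> x \<bullet>\<^sub>r 1\<^sub>m n = (x :: 'a::field vec)"
  by (simp add: row_mult_eq_transpose[of _ n n] transpose_one)

lemma row_mult_index:
  assumes "A \<in> carrier_mat n k" "x \<in> carrier_vec n" "j < k"
  shows "(x \<bullet>\<^sub>r A) $ j = (\<Sum>i<n. x $ i * A $$ (i, j))"
  using assms by (auto simp: row_mult_def scalar_prod_def atLeast0LessThan intro!: sum.cong)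

lemma rank_one_carrier [simp]: "rank_one n c u \<in> carrier_mat n n"
  by (simp add: rank_one_def)

lemma row_mult_rank_one:
  assumes "x \<in> carrier_vec n" "c \<in> carrier_vec n" "u \<in> carrier_vec n"
  shows "x \<bullet>\<^sub>r rank_one n c u = x + scalar_prod x c \<cdot>\<^sub>v (u :: 'a::field vec)"
proof (rule eq_vecI)
  fix j assume "j < dim_vec (x + scalar_prod x c \<cdot>\<^sub>v u)"
  then have j: "j < n"
    using assms by simp
  have "(x \<bullet>\<^sub>r rank_one n c u) $ j
      = (\<Sum>i<n. (if i = j then x $ i else 0) + x $ i * c $ i * u $ j)"
    using j assms
    by (subst row_mult_index[of _ n n]) (auto simp: rank_one_def algebra_simps intro!: sum.cong)
  also have "\<dots> = x $ j + (\<Sum>i<n. x $ i * c $ i) * u $ j"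
    using j by (simp add: sum.distrib sum_distrib_right)
  finally show "(x \<bullet>\<^sub>r rank_one n c u) $ j = (x + scalar_prod x c \<cdot>\<^sub>v u) $ j"
    using j assms by (simp add: scalar_prod_def atLeast0LessThan)
qed (use assms in \<open>auto simp: rank_one_def\<close>)

text \<open>With c fixed these matrices are closed under products, because the product of c u^T and
  c u'^T is the scalar u^T c times c u'^T. Inverting one of them thus reduces to a linear equation
  in u'.\<close>

lemma rank_one_mult:
  assumes "c \<in> carrier_vec n" "u \<in> carrier_vec n" "u' \<in> carrier_vec n"
  shows "rank_one n c u * rank_one n c u'
    = rank_one n c (u + u' + scalar_prod u c \<cdot>\<^sub>v (u' :: 'a::field vec))"
proof (rule eq_matI)
  fix i j assume "i < dim_row (rank_one n c (u + u' + scalar_prod u c \<cdot>\<^sub>v u'))"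
    "j < dim_col (rank_one n c (u + u' + scalar_prod u c \<cdot>\<^sub>v u'))"
  then have ij: "i < n" "j < n"
    by (auto simp: rank_one_def)
  have "(rank_one n c u * rank_one n c u') $$ (i, j)
     = (\<Sum>l<n. ((if i = l then 1 else 0) + c $ i * u $ l) * ((if l = j then 1 else 0) + c $ l * u' $ j))"
    using ij assms by (simp add: rank_one_def scalar_prod_def atLeast0LessThan)
  also have "\<dots> = (\<Sum>l<n. (if i = l then (if i = j then 1 else 0) + c $ l * u' $ j else 0)
      + (if l = j then c $ i * u $ l else 0) + c $ i * (u $ l * c $ l) * u' $ j)"
    by (intro sum.cong) (auto simp: algebra_simps)
  also have "\<dots> = (if i = j then 1 else 0) + c $ i * u' $ j + c $ i * u $ j
      + c $ i * (\<Sum>l<n. u $ l * c $ l) * u' $ j"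
    using ij by (simp add: sum.distrib sum_distrib_right sum_distrib_left)
  finally show "(rank_one n c u * rank_one n c u') $$ (i, j)
    = rank_one n c (u + u' + scalar_prod u c \<cdot>\<^sub>v u') $$ (i, j)"
    using ij assms
    by (simp add: rank_one_def scalar_prod_def atLeast0LessThan algebra_simps)
qed (auto simp: rank_one_def)

lemma rank_one_zero [simp]: "rank_one n c (0\<^sub>v n) = (1\<^sub>m n :: 'a::field mat)"
  by (rule eq_matI) (auto simp: rank_one_def)

text \<open>The Sherman-Morrison formula: the equation u + u' + (u^T c) u' = 0 is solved by a
  multiple of u. Both products are recorded, since \<open>Units\<close> asks for a two-sided
  inverse.\<close>

lemma rank_one_inverse:
  fixes c u :: "'a::field vec"
  assumes c: "c \<in> carrier_vec n" and u: "u \<in> carrier_vec n"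
    and s: "1 + scalar_prod u c \<noteq> 0"
  defines "u' \<equiv> (- 1 / (1 + scalar_prod u c)) \<cdot>\<^sub>v u"
  shows "rank_one n c u * rank_one n c u' = 1\<^sub>m n"
    and "rank_one n c u' * rank_one n c u = 1\<^sub>m n"
proof -
  have u': "u' \<in> carrier_vec n"
    using u by (simp add: u'_def)
  have sp: "scalar_prod u' c = (- 1 / (1 + scalar_prod u c)) * scalar_prod u c"
    using c u by (simp add: u'_def)
  let ?s = "scalar_prod u c"
  have "u + u' + ?s \<cdot>\<^sub>v u' = 0\<^sub>v n"
  proof (rule eq_vecI)
    fix i assume "i < dim_vec (0\<^sub>v n :: 'a vec)"
    then have i: "i < n" by simp
    have "(u + u' + ?s \<cdot>\<^sub>v u') $ i = u $ i * (1 - 1 / (1 + ?s) - ?s / (1 + ?s))"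
      using i u by (simp add: u'_def algebra_simps)
    also have "1 - 1 / (1 + ?s) - ?s / (1 + ?s) = 0"
      using s by (simp add: field_simps)
    finally show "(u + u' + ?s \<cdot>\<^sub>v u') $ i = 0\<^sub>v n $ i"
      using i by simp
  qed (use u u' in auto)
  then show "rank_one n c u * rank_one n c u' = 1\<^sub>m n"
    using rank_one_mult[OF c u u'] by simp
  have "u' + u + scalar_prod u' c \<cdot>\<^sub>v u = 0\<^sub>v n"
  proof (rule eq_vecI)
    fix i assume "i < dim_vec (0\<^sub>v n :: 'a vec)"
    then have i: "i < n" by simp
    have "(u' + u + scalar_prod u' c \<cdot>\<^sub>v u) $ i = u $ i * (1 - 1 / (1 + ?s) - ?s / (1 + ?s))"
      using i u unfolding sp by (simp add: u'_def algebra_simps)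
    also have "1 - 1 / (1 + ?s) - ?s / (1 + ?s) = 0"
      using s by (simp add: field_simps)
    finally show "(u' + u + scalar_prod u' c \<cdot>\<^sub>v u) $ i = 0\<^sub>v n $ i"
      using i by simp
  qed (use u u' in auto)
  then show "rank_one n c u' * rank_one n c u = 1\<^sub>m n"
    using rank_one_mult[OF c u' u] by simp
qed

subsection \<open>Nonarchimedean absolute values\<close>

context nonarch_abs
begin

lemma abs_inverse: "v (inverse x) = inverse (v x)"
proof (cases "x = 0")
  case False
  then have "v x * v (inverse x) = 1"
    using mult[of x "inverse x"] abs_one by simp
  then show ?thesis
    by (simp add: inverse_unique)
qed simp

lemma abs_divide: "v (x / y) = v x / v y"
  by (simp add: divide_inverse mult abs_inverse)

lemma abs_power: "v (x ^ k) = v x ^ k"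
  by (induction k) (auto simp: mult abs_one)

lemma abs_diff_le: "v (x - y) \<le> max (v x) (v y)"
  using ultrametric[of x "- y"] by (simp add: abs_minus)

lemma abs_add_eq: "v y < v x \<Longrightarrow> v (x + y) = v x"
  using ultrametric[of x y] abs_diff_le[of "x + y" y] by auto

lemma abs_eq_of_diff: "v (x - y) < v x \<Longrightarrow> v y = v x"
  using abs_add_eq[of "- (x - y)" x] by (simp add: abs_minus abs_diff_commute)

lemma abs_sum_le:
  assumes "\<And>i. i \<in> I \<Longrightarrow> v (f i) \<le> r" "0 \<le> r"
  shows "v (sum f I) \<le> r"
  using assms
proof (induction I rule: infinite_finite_induct)
  case (insert i I)
  then show ?case
    using ultrametric[of "f i" "sum f I"] by fastforce
qed auto

lemma integers_iff: "x \<in> integers v \<longleftrightarrow> v x \<le> 1"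
  by (simp add: integers_def)

lemma integer_units_iff: "x \<in> integer_units v \<longleftrightarrow> v x = 1"
proof
  assume "x \<in> integer_units v"
  then obtain y where y: "v x \<le> 1" "v y \<le> 1" "x * y = 1"
    by (auto simp: integer_units_def integers_def)
  then have "v x * v y = 1"
    using mult[of x y] abs_one by simp
  moreover have "v x * v y \<le> v x * 1"
    using y nonneg by (intro mult_left_mono) auto
  ultimately show "v x = 1"
    using y by simp
next
  assume x: "v x = 1"
  then have "x \<noteq> 0"
    by auto
  then show "x \<in> integer_units v"
    using x by (auto simp: integer_units_def integers_def abs_inverse intro!: exI[of _ "inverse x"])
qed

lemma sup_abs_le_iff: "N > 0 \<Longrightarrow> sup_abs v N x \<le> r \<longleftrightarrow> (\<forall>i<N. v (x $ i) \<le> r)"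
  unfolding sup_abs_def by (subst Max_le_iff) (auto simp: lessThan_empty_iff)

lemma abs_le_sup_abs: "i < N \<Longrightarrow> v (x $ i) \<le> sup_abs v N x"
  unfolding sup_abs_def by (intro Max_ge) auto

lemma sup_abs_attained:
  assumes "N > 0"
  obtains i where "i < N" "v (x $ i) = sup_abs v N x"
proof -
  have "sup_abs v N x \<in> (\<lambda>i. v (x $ i)) ` {..<N}"
    unfolding sup_abs_def using assms by (intro Max_in) (auto simp: lessThan_empty_iff)
  then show ?thesis
    using that by auto
qed

lemma sup_abs_nonneg: "N > 0 \<Longrightarrow> 0 \<le> sup_abs v N x"
  using abs_le_sup_abs[of 0 N x] nonneg[of "x $ 0"] by simp

lemma sup_abs_cong_le:
  assumes "N > 0" "\<And>i. i < N \<Longrightarrow> v (x $ i - y $ i) \<le> r"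
  shows "sup_abs v N y \<le> max (sup_abs v N x) r"
  unfolding sup_abs_le_iff[OF \<open>N > 0\<close>]
proof (intro allI impI)
  fix i assume i: "i < N"
  have "v (y $ i) \<le> max (v (x $ i)) (v (x $ i - y $ i))"
    using abs_diff_le[of "x $ i" "x $ i - y $ i"] by simp
  then show "v (y $ i) \<le> max (sup_abs v N x) r"
    using abs_le_sup_abs[OF i, of x] assms(2)[OF i] by linarith
qed

text \<open>Ultrametric rigidity: an error of size r is absorbed by a bound of r, and a maximum
  larger than r survives it unchanged. The first part makes the sets M <= q^(-j) unions of
  congruence classes; the second serves where M is larger than the modulus of the
  congruence.\<close>

lemma sup_abs_cong:
  assumes "N > 0" "\<And>i. i < N \<Longrightarrow> v (x $ i - y $ i) \<le> r"
  shows "sup_abs v N x \<le> r \<longleftrightarrow> sup_abs v N y \<le> r"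
    and "r < sup_abs v N x \<Longrightarrow> sup_abs v N y = sup_abs v N x"
  using sup_abs_cong_le[OF assms] sup_abs_cong_le[of N y x r] assms
  by (auto simp: abs_diff_commute)

subsection \<open>The group of integral invertible matrices\<close>

lemma mat_monoid_simps [simp]:
  "monoid.mult (mat_monoid v n) = (*)" "one (mat_monoid v n) = 1\<^sub>m n"
  by (simp_all add: mat_monoid_def)

lemma elements_mat_integers_iff:
  "A \<in> carrier_mat k l \<Longrightarrow> elements_mat A \<subseteq> integers v \<longleftrightarrow> (\<forall>i<k. \<forall>j<l. v (A $$ (i, j)) \<le> 1)"
  by (force simp: integers_def dest: elements_matD)

lemma mat_monoid_carrier_iff:
  "A \<in> carrier (mat_monoid v n) \<longleftrightarrow>
    A \<in> carrier_mat n n \<and> (\<forall>i<n. \<forall>j<n. v (A $$ (i, j)) \<le> 1)"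
  using elements_mat_integers_iff[of A n n] by (auto simp: mat_monoid_def)

lemma abs_mat_mult_le:
  assumes "A \<in> carrier_mat n k" "B \<in> carrier_mat k l" "i < n" "j < l" "0 \<le> r" "0 \<le> s"
    "\<And>h. h < k \<Longrightarrow> v (A $$ (i, h)) \<le> r" "\<And>h. h < k \<Longrightarrow> v (B $$ (h, j)) \<le> s"
  shows "v ((A * B) $$ (i, j)) \<le> r * s"
proof -
  have "v (\<Sum>h<k. A $$ (i, h) * B $$ (h, j)) \<le> r * s"
    using assms nonneg by (intro abs_sum_le) (auto simp: mult intro!: mult_mono)
  then show ?thesis
    using assms(1-4) by (simp add: scalar_prod_def atLeast0LessThan)
qed

lemma monoid_mat_monoid: "monoid (mat_monoid v n)"
proof (rule monoidI)
  fix A B assume "A \<in> carrier (mat_monoid v n)" "B \<in> carrier (mat_monoid v n)"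
  then show "A \<otimes>\<^bsub>mat_monoid v n\<^esub> B \<in> carrier (mat_monoid v n)"
    using abs_mat_mult_le[of A n n B n _ _ 1 1] by (auto simp: mat_monoid_carrier_iff)
qed (auto simp: mat_monoid_carrier_iff abs_one)

lemma GL_I:
  assumes "A \<in> carrier_mat n n" "B \<in> carrier_mat n n"
    "\<And>i j. i < n \<Longrightarrow> j < n \<Longrightarrow> v (A $$ (i, j)) \<le> 1"
    "\<And>i j. i < n \<Longrightarrow> j < n \<Longrightarrow> v (B $$ (i, j)) \<le> 1"
    "A * B = 1\<^sub>m n" "B * A = 1\<^sub>m n"
  shows "A \<in> GL v n"
  using assms by (auto simp: GL_def Units_def mat_monoid_carrier_iff)

lemma GL_D:
  assumes "A \<in> GL v n"
  shows "A \<in> carrier_mat n n" "\<And>i j. i < n \<Longrightarrow> j < n \<Longrightarrow> v (A $$ (i, j)) \<le> 1"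
  using assms by (auto simp: GL_def Units_def mat_monoid_carrier_iff)

lemma GL_inv:
  assumes "A \<in> GL v n"
  defines "B \<equiv> inv\<^bsub>mat_monoid v n\<^esub> A"
  shows "B \<in> GL v n" "A * B = 1\<^sub>m n" "B * A = 1\<^sub>m n"
  using assms monoid.Units_inv_Units[OF monoid_mat_monoid] monoid.Units_r_inv[OF monoid_mat_monoid]
    monoid.Units_l_inv[OF monoid_mat_monoid] by (fastforce simp: GL_def)+

lemma GL_mult: "A \<in> GL v n \<Longrightarrow> B \<in> GL v n \<Longrightarrow> A * B \<in> GL v n"
  using monoid.Units_m_closed[OF monoid_mat_monoid] by (fastforce simp: GL_def)

lemma GL_one: "1\<^sub>m n \<in> GL v n"
  using monoid.Units_one_closed[OF monoid_mat_monoid] by (fastforce simp: GL_def)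

text \<open>The inverse has the same form, with u divided by minus the unit 1 + u^T c, and is
  therefore integral.\<close>

lemma rank_one_GL:
  assumes "c \<in> carrier_vec n" "u \<in> carrier_vec n"
    and c: "\<And>i. i < n \<Longrightarrow> v (c $ i) \<le> 1" and u: "\<And>i. i < n \<Longrightarrow> v (u $ i) \<le> 1"
    and s: "v (1 + scalar_prod u c) = 1"
  shows "rank_one n c u \<in> GL v n"
proof (rule GL_I)
  let ?u' = "(- 1 / (1 + scalar_prod u c)) \<cdot>\<^sub>v u"
  have s0: "1 + scalar_prod u c \<noteq> 0"
    using s by auto
  show "rank_one n c u * rank_one n c ?u' = 1\<^sub>m n" "rank_one n c ?u' * rank_one n c u = 1\<^sub>m n"
    using rank_one_inverse[OF assms(1,2) s0] by auto
  have *: "v (rank_one n c t $$ (i, j)) \<le> 1"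
    if "i < n" "j < n" "v (t $ j) \<le> 1" for i j and t :: "'a vec"
  proof -
    have "v (c $ i * t $ j) \<le> 1"
      using that c[of i] nonneg by (simp add: mult mult_le_one)
    then show ?thesis
      using ultrametric[of "if i = j then 1 else 0" "c $ i * t $ j"] that
      by (auto simp: rank_one_def abs_one)
  qed
  show "v (rank_one n c u $$ (i, j)) \<le> 1" if "i < n" "j < n" for i j
    using * that u by auto
  show "v (rank_one n c ?u' $$ (i, j)) \<le> 1" if "i < n" "j < n" for i j
    using * that u[of j] assms(2) s by (auto simp: mult abs_divide abs_minus abs_one)
qed auto

lemma row_mult_abs_le:
  assumes "A \<in> carrier_mat n k" "x \<in> carrier_vec n" "j < k" "0 \<le> r" "0 \<le> s"
    "\<And>i. i < n \<Longrightarrow> v (x $ i) \<le> r" "\<And>i. i < n \<Longrightarrow> v (A $$ (i, j)) \<le> s"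
  shows "v ((x \<bullet>\<^sub>r A) $ j) \<le> r * s"
  unfolding row_mult_index[OF assms(1-3)]
  using assms nonneg by (intro abs_sum_le) (auto simp: mult intro!: mult_mono)

text \<open>An integral matrix cannot increase the maximum, and applying this to the inverse matrix
  gives the reverse inequality.\<close>

lemma sup_abs_row_mult_GL:
  assumes "k \<in> GL v N" "x \<in> carrier_vec N" "N > 0"
  shows "sup_abs v N (x \<bullet>\<^sub>r k) = sup_abs v N x"
proof -
  have le: "sup_abs v N (y \<bullet>\<^sub>r g) \<le> sup_abs v N y"
    if "g \<in> GL v N" "y \<in> carrier_vec N" for g y
    unfolding sup_abs_le_iff[OF \<open>N > 0\<close>]
    using that row_mult_abs_le[of g N N y _ "sup_abs v N y" 1] GL_D[OF that(1)] abs_le_sup_abs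
      sup_abs_nonneg[OF \<open>N > 0\<close>] by auto
  let ?h = "inv\<^bsub>mat_monoid v N\<^esub> k"
  have "x \<bullet>\<^sub>r k \<bullet>\<^sub>r ?h = x"
    using row_mult_assoc[of k N N ?h N x] GL_inv[OF assms(1)] GL_D(1) assms by simp
  then show ?thesis
    using le[OF assms(1,2)] le[of ?h "x \<bullet>\<^sub>r k"] GL_inv[OF assms(1)] GL_D(1)[OF assms(1)] by auto
qed

section \<open>The unit sphere and the orbits on it\<close>

lemma unit_sphere_iff: "x \<in> unit_sphere v n \<longleftrightarrow> x \<in> carrier_vec n \<and> sup_abs v n x = 1"
  by (simp add: unit_sphere_def sup_abs_def)

lemma unit_sphere_abs_le: "x \<in> unit_sphere v n \<Longrightarrow> i < n \<Longrightarrow> v (x $ i) \<le> 1"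
  using abs_le_sup_abs[of i n x] by (simp add: unit_sphere_iff)

lemma unit_sphere_row_mult:
  "x \<in> unit_sphere v n \<Longrightarrow> k \<in> GL v n \<Longrightarrow> n > 0 \<Longrightarrow> x \<bullet>\<^sub>r k \<in> unit_sphere v n"
  using sup_abs_row_mult_GL[of k n x] GL_D(1)[of k n] by (auto simp: unit_sphere_iff)

lemma unit_sphere_smult:
  assumes "x \<in> unit_sphere v n" "v a = 1"
  shows "a \<cdot>\<^sub>v x \<in> unit_sphere v n"
proof -
  have "(\<lambda>i. v ((a \<cdot>\<^sub>v x) $ i)) ` {..<n} = (\<lambda>i. v (x $ i)) ` {..<n}"
    using assms by (intro image_cong) (auto simp: unit_sphere_def mult)
  then show ?thesis
    using assms by (auto simp: unit_sphere_def)
qed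

lemma e_last_sphere: "n > 0 \<Longrightarrow> e_last n \<in> unit_sphere v n"
  unfolding unit_sphere_iff
proof
  assume n: "n > 0"
  have "sup_abs v n (e_last n) \<le> 1"
    using n by (auto simp: sup_abs_le_iff e_last_def abs_one)
  moreover have "1 \<le> sup_abs v n (e_last n)"
    using abs_le_sup_abs[of "n - 1" n "e_last n"] n by (auto simp: e_last_def abs_one)
  ultimately show "sup_abs v n (e_last n) = 1"
    by simp
qed (simp add: e_last_def)

text \<open>The vector \<open>c\<close> is a sum of at most two coordinate functionals; two are needed when \<open>y\<close>
  and \<open>z\<close> attain their maxima at different coordinates only.\<close>

lemma ex_norming_functional:
  assumes "N > 0" "y \<in> carrier_vec N" "z \<in> carrier_vec N"
    and "sup_abs v N y = r" "sup_abs v N z = r"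
  shows "\<exists>c \<in> carrier_vec N. (\<forall>i<N. v (c $ i) \<le> 1) \<and>
    v (scalar_prod y c) = r \<and> v (scalar_prod z c) = r"
proof -
  obtain i where i: "i < N" "v (y $ i) = r"
    using sup_abs_attained[OF \<open>N > 0\<close>] assms by metis
  obtain j where j: "j < N" "v (z $ j) = r"
    using sup_abs_attained[OF \<open>N > 0\<close>] assms by metis
  have le: "v (y $ j) \<le> r" "v (z $ i) \<le> r"
    using abs_le_sup_abs i j assms by metis+
  consider "v (z $ i) = r" | "v (y $ j) = r" | "v (z $ i) < r" "v (y $ j) < r"
    using le by linarith
  then show ?thesis
  proof cases
    case 1
    then show ?thesis
      using i assms by (intro bexI[of _ "unit_vec N i"]) (auto simp: abs_one)
  next
    case 2
    then show ?thesis
      using j assms by (intro bexI[of _ "unit_vec N j"]) (auto simp: abs_one)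
  next
    case 3
    then have ij: "i \<noteq> j"
      using i by auto
    let ?c = "unit_vec N i + unit_vec N j"
    have "scalar_prod y ?c = y $ i + y $ j" "scalar_prod z ?c = z $ j + z $ i"
      using i j assms by (simp_all add: scalar_prod_add_distrib[of _ N] add.commute)
    then show ?thesis
      using 3 i j ij by (intro bexI[of _ ?c]) (auto simp: abs_one abs_add_eq)
  qed
qed

text \<open>If y c and z c are units and u = (z - y) / (y c), then 1 + u^T c = (z c) / (y c) is a
  unit with no further condition. The case r = 1 yields transitivity on the sphere, the case r =
  q^(-m) the orbits of the congruence subgroup.\<close>

lemma sphere_orbit:
  assumes "n > 0" "y \<in> unit_sphere v n" "z \<in> unit_sphere v n"
    and "\<And>i. i < n \<Longrightarrow> v (z $ i - y $ i) \<le> r" "r \<le> 1"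
  shows "\<exists>k \<in> GL v n. (\<forall>i<n. \<forall>j<n. v (k $$ (i, j) - 1\<^sub>m n $$ (i, j)) \<le> r) \<and> y \<bullet>\<^sub>r k = z"
proof -
  have yz: "y \<in> carrier_vec n" "z \<in> carrier_vec n"
    using assms by (auto simp: unit_sphere_iff)
  obtain c where c: "c \<in> carrier_vec n" "\<And>i. i < n \<Longrightarrow> v (c $ i) \<le> 1"
    "v (scalar_prod y c) = 1" "v (scalar_prod z c) = 1"
    using ex_norming_functional[OF \<open>n > 0\<close> yz, of 1] assms by (auto simp: unit_sphere_iff)
  let ?s = "scalar_prod y c"
  have s0: "?s \<noteq> 0"
    using c by auto
  define u where "u = (1 / ?s) \<cdot>\<^sub>v (z - y)"
  have u: "u \<in> carrier_vec n" "\<And>i. i < n \<Longrightarrow> v (u $ i) \<le> r"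
    using yz c assms by (auto simp: u_def mult abs_divide abs_one)
  have "1 + scalar_prod u c = 1 + (scalar_prod z c - ?s) / ?s"
    using yz c(1) by (simp add: u_def minus_scalar_prod_distrib[of _ n])
  also have "\<dots> = scalar_prod z c / ?s"
    using s0 by (simp add: field_simps)
  finally have "v (1 + scalar_prod u c) = 1"
    using c by (simp add: abs_divide)
  then have "rank_one n c u \<in> GL v n"
    using c u assms(5) by (intro rank_one_GL) (auto intro: order_trans)
  moreover have "y \<bullet>\<^sub>r rank_one n c u = z"
    unfolding row_mult_rank_one[OF yz(1) c(1) u(1)]
    using s0 yz by (intro eq_vecI) (auto simp: u_def)
  moreover have "v (rank_one n c u $$ (i, j) - 1\<^sub>m n $$ (i, j)) \<le> r" if "i < n" "j < n" for i j
  proof -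
    have "v (c $ i) * v (u $ j) \<le> 1 * r"
      using c u that nonneg by (intro mult_mono) auto
    then show ?thesis
      using that by (simp add: rank_one_def mult)
  qed
  ultimately show ?thesis
    by blast
qed

text \<open>A zero last entry of c makes the last row of the matrix that of the identity. The last
  entry of u then drops out of the unit condition and only contributes to the column b.\<close>

lemma rank_one_mirabolic:
  assumes n: "n \<ge> 2" and c: "c \<in> carrier_vec (n - 1)" "\<And>i. i < n - 1 \<Longrightarrow> v (c $ i) \<le> 1"
    and u: "u \<in> carrier_vec n" "\<And>i. i < n \<Longrightarrow> v (u $ i) \<le> 1"
    and s: "v (1 + (\<Sum>i<n - 1. u $ i * c $ i)) = 1"
  shows "rank_one n (vec n (\<lambda>i. if i < n - 1 then c $ i else 0)) u \<in> mirabolic v n"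
proof -
  let ?c = "vec n (\<lambda>i. if i < n - 1 then c $ i else 0)"
  let ?u = "vec (n - 1) (\<lambda>i. u $ i)"
  let ?b = "mat (n - 1) 1 (\<lambda>(i, j). c $ i * u $ (n - 1))"
  have split: "{..<n} = insert (n - 1) {..<n - 1}"
    using n by auto
  have "scalar_prod u ?c = (\<Sum>i<n - 1. u $ i * c $ i)"
    unfolding scalar_prod_def atLeast0LessThan dim_vec split
    using n by (simp del: One_nat_def)
  then have 1: "rank_one n ?c u \<in> GL v n"
    using c u s by (intro rank_one_GL) auto
  have "scalar_prod ?u c = (\<Sum>i<n - 1. u $ i * c $ i)"
    using c by (simp add: scalar_prod_def atLeast0LessThan)
  then have 2: "rank_one (n - 1) c ?u \<in> GL v (n - 1)"
    using c u s by (intro rank_one_GL) auto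
  have 3: "elements_mat ?b \<subseteq> integers v"
    using n c u nonneg
    by (subst elements_mat_integers_iff[of _ "n - 1" 1]) (auto simp: mult intro!: mult_le_one)
  have 4: "rank_one n ?c u = four_block_mat (rank_one (n - 1) c ?u) ?b (0\<^sub>m 1 (n - 1)) (1\<^sub>m 1)"
  proof (rule eq_matI)
    fix i j assume "i < dim_row (four_block_mat (rank_one (n - 1) c ?u) ?b (0\<^sub>m 1 (n - 1)) (1\<^sub>m 1))"
      "j < dim_col (four_block_mat (rank_one (n - 1) c ?u) ?b (0\<^sub>m 1 (n - 1)) (1\<^sub>m 1))"
    then have "i < n" "j < n"
      using n by (auto simp: rank_one_def)
    moreover have "i < n - 1 \<or> i = n - 1" "j < n - 1 \<or> j = n - 1"
      using \<open>i < n\<close> \<open>j < n\<close> by auto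
    ultimately show "rank_one n ?c u $$ (i, j)
        = four_block_mat (rank_one (n - 1) c ?u) ?b (0\<^sub>m 1 (n - 1)) (1\<^sub>m 1) $$ (i, j)"
      using n by (elim disjE) (auto simp: rank_one_def)
  qed (use n in \<open>auto simp: rank_one_def\<close>)
  show ?thesis
    unfolding mirabolic_def mem_Collect_eq
    by (intro conjI exI[of _ "rank_one (n - 1) c ?u"] exI[of _ ?b] 1 2 3 4) auto
qed

text \<open>The functional c reads the first n - 1 coordinates only. Its value on x has absolute
  value r, so u stays integral after division by it as long as z - x has entries of size at most r:
  the first n - 1 do because of the common maximum, the last one by \<open>last\<close>.\<close>

lemma mirabolic_orbit:
  assumes n: "n \<ge> 2" and x: "x \<in> carrier_vec n" "z \<in> carrier_vec n"
    and r: "sup_abs v (n - 1) x = r" "sup_abs v (n - 1) z = r" "r > 0"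
    and last: "v (z $ (n - 1) - x $ (n - 1)) \<le> r"
  shows "\<exists>k \<in> mirabolic v n. x \<bullet>\<^sub>r k = z"
proof -
  let ?h = "\<lambda>y :: 'a vec. vec (n - 1) (\<lambda>i. y $ i)"
  have head: "sup_abs v (n - 1) (?h y) = sup_abs v (n - 1) y" for y
    unfolding sup_abs_def by (rule arg_cong[of _ _ Max]) (auto intro!: image_cong)
  obtain c where c: "c \<in> carrier_vec (n - 1)" "\<And>i. i < n - 1 \<Longrightarrow> v (c $ i) \<le> 1"
    "v (scalar_prod (?h x) c) = r" "v (scalar_prod (?h z) c) = r"
    using ex_norming_functional[of "n - 1" "?h x" "?h z" r] r n unfolding head by auto
  define sp where "sp y = (\<Sum>i<n - 1. y $ i * c $ i)" for y :: "'a vec"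
  have sp: "scalar_prod (?h y) c = sp y" for y
    using c(1) by (simp add: scalar_prod_def sp_def atLeast0LessThan)
  have vs: "v (sp x) = r" "v (sp z) = r"
    using c(3,4) unfolding sp by auto
  then have s0: "sp x \<noteq> 0"
    using r by auto
  define u where "u = (1 / sp x) \<cdot>\<^sub>v (z - x)"
  have "v (z $ i - x $ i) \<le> r" if i: "i < n" for i
  proof (cases "i = n - 1")
    case False
    then have "i < n - 1" using i by auto
    then show ?thesis
      using abs_diff_le[of "z $ i" "x $ i"] abs_le_sup_abs[of i "n - 1"] r by (smt (verit))
  qed (use last in auto)
  then have u: "u \<in> carrier_vec n" "\<And>i. i < n \<Longrightarrow> v (u $ i) \<le> 1"
    using x r vs by (auto simp: u_def mult abs_divide abs_one)
  have "sp u = (sp z - sp x) / sp x"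
    using x unfolding sp_def u_def
    by (simp add: sum_divide_distrib diff_divide_distrib left_diff_distrib flip: sum_subtractf)
  then have "1 + sp u = sp z / sp x"
    using s0 by (simp add: field_simps)
  then have "v (1 + sp u) = 1"
    using vs r by (simp add: abs_divide)
  then have "rank_one n (vec n (\<lambda>i. if i < n - 1 then c $ i else 0)) u \<in> mirabolic v n"
    using n c u by (intro rank_one_mirabolic) (auto simp: sp_def)
  moreover have "x \<bullet>\<^sub>r rank_one n (vec n (\<lambda>i. if i < n - 1 then c $ i else 0)) u = z"
  proof -
    have split: "{..<n} = insert (n - 1) {..<n - 1}"
      using n by auto
    have "scalar_prod x (vec n (\<lambda>i. if i < n - 1 then c $ i else 0)) = sp x"
      unfolding scalar_prod_def atLeast0LessThan dim_vec split sp_def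
      using n by (simp del: One_nat_def)
    then show ?thesis
      using s0 x u(1) by (subst row_mult_rank_one) (auto simp: u_def)
  qed
  ultimately show ?thesis
    by blast
qed

end

subsection \<open>Residue classes in a local field\<close>

lemma (in nonarch_abs) abs_diff_trans: "v (a - b) \<le> r \<Longrightarrow> v (b - c) \<le> r \<Longrightarrow> v (a - c) \<le> r"
  using ultrametric[of "a - b" "b - c"] by simp

context nonarch_local_field
begin

lemma residue_field_nonempty: "residue_field v \<noteq> {}"
proof -
  have "0 \<in> integers v"
    by (simp add: integers_iff)
  then show ?thesis
    by (auto simp: residue_field_def quotient_def)
qed

lemma abs_uniformiser_pos: "0 < v w"
  using residue_field_nonempty finite_residue_field abs_uniformiser
  by (simp add: residue_order_def card_gt_0_iff)

lemma uniformiser_nonzero: "w \<noteq> 0"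
  using abs_uniformiser_pos by auto

lemma abs_uniformiser_less_one: "v w < 1"
proof -
  have "w \<in> (\<lambda>y. w * y) ` integers v"
    by (intro image_eqI[of _ _ 1]) (auto simp: integers_iff abs_one)
  then show ?thesis
    using uniformiser by (auto simp: max_ideal_def)
qed

lemma residue_order_ge_2: "residue_order v \<ge> 2"
proof -
  have "real (residue_order v) > 1"
    using abs_uniformiser_pos abs_uniformiser_less_one abs_uniformiser
    by (cases "residue_order v = 0") (auto simp: field_simps)
  then show ?thesis
    by simp
qed

lemma powers_pos [simp]: "0 < v w ^ m"
  using abs_uniformiser_pos by simp

lemma powers_le_one [simp]: "v w ^ m \<le> 1"
  using abs_uniformiser_pos abs_uniformiser_less_one by (simp add: power_le_one)

lemma powers_less_one: "m > 0 \<Longrightarrow> v w ^ m < 1"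
  using abs_uniformiser_pos abs_uniformiser_less_one by (simp add: power_Suc_less_one power_less_one_iff)

lemma powers_antimono: "j \<le> m \<Longrightarrow> v w ^ m \<le> v w ^ j"
  using abs_uniformiser_pos abs_uniformiser_less_one by (simp add: power_decreasing)

lemma abs_less_one_imp_le: "v x < 1 \<Longrightarrow> v x \<le> v w"
proof -
  assume "v x < 1"
  then obtain y where "v y \<le> 1" "x = w * y"
    using uniformiser by (auto simp: max_ideal_def integers_def)
  then show ?thesis
    using abs_uniformiser_pos by (simp add: mult)
qed

lemma abs_less_power_imp_le:
  assumes "v x < v w ^ j"
  shows "v x \<le> v w ^ Suc j"
proof -
  have "v (x / w ^ j) \<le> v w"
    using assms by (intro abs_less_one_imp_le) (simp add: abs_divide abs_power)
  then show ?thesis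
    by (simp add: abs_divide abs_power field_simps)
qed

lemma ideal_power_iff: "x \<in> ideal_power v w m \<longleftrightarrow> v x \<le> v w ^ m"
proof
  assume "v x \<le> v w ^ m"
  then have "v (x / w ^ m) \<le> 1"
    by (simp add: abs_divide abs_power)
  then show "x \<in> ideal_power v w m"
    using uniformiser_nonzero
    by (auto simp: ideal_power_def integers_def intro!: image_eqI[of _ _ "x / w ^ m"])
next
  assume "x \<in> ideal_power v w m"
  then obtain y where y: "v y \<le> 1" "x = w ^ m * y"
    by (auto simp: ideal_power_def integers_def)
  then have "v x \<le> v w ^ m * 1"
    unfolding y(2) mult abs_power by (intro mult_left_mono) (auto simp: less_imp_le)
  then show "v x \<le> v w ^ m"
    by simp
qed

text \<open>At level 0 the congruence is automatic for units; at positive level the congruence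
  itself forces a unit. One criterion thus serves all levels.\<close>

lemma unit_filtration_iff: "u \<in> unit_filtration v w m \<longleftrightarrow> v u = 1 \<and> v (u - 1) \<le> v w ^ m"
proof (cases "m = 0")
  case True
  then show ?thesis
    using abs_diff_le[of u 1] by (auto simp: unit_filtration_def integer_units_iff abs_one)
next
  case False
  have "v u = 1" if "v (u - 1) \<le> v w ^ m"
    using abs_eq_of_diff[of 1 u] that powers_less_one[of m] False
    by (simp add: abs_one abs_diff_commute)
  moreover have "u \<in> (\<lambda>y. 1 + y) ` ideal_power v w m \<longleftrightarrow> u - 1 \<in> ideal_power v w m"
    by (auto intro: image_eqI[of _ _ "u - 1"])
  ultimately show ?thesis
    using False by (auto simp: unit_filtration_def ideal_power_iff)
qed

lemma congruence_subgroup_iff: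
  "k \<in> congruence_subgroup v w n m \<longleftrightarrow> k \<in> GL v n \<and>
    (\<forall>i<n. \<forall>j<n. v (k $$ (i, j) - 1\<^sub>m n $$ (i, j)) \<le> v w ^ m)"
proof -
  have "elements_mat (k - 1\<^sub>m n) \<subseteq> ideal_power v w m \<longleftrightarrow>
      (\<forall>i<n. \<forall>j<n. v (k $$ (i, j) - 1\<^sub>m n $$ (i, j)) \<le> v w ^ m)" if "k \<in> carrier_mat n n"
  proof -
    have "k - 1\<^sub>m n \<in> carrier_mat n n"
      using that by auto
    then have "elements_mat (k - 1\<^sub>m n) \<subseteq> ideal_power v w m \<longleftrightarrow>
        (\<forall>i<n. \<forall>j<n. (k - 1\<^sub>m n) $$ (i, j) \<in> ideal_power v w m)"
      by (force dest: elements_matD)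
    then show ?thesis
      using that by (simp add: ideal_power_iff)
  qed
  then show ?thesis
    unfolding congruence_subgroup_def using GL_D(1) by blast
qed

text \<open>The coset x + p^m as a subset of the field. For integral x and m = 1 these are exactly
  the elements of \<open>residue_field v\<close>, so the same sets can serve as labels in counting
  arguments.\<close>

definition res_class :: "nat \<Rightarrow> 'a \<Rightarrow> 'a set" where
  "res_class m x = {y. v (x - y) \<le> v w ^ m}"

lemma res_class_eq_iff: "res_class m x = res_class m y \<longleftrightarrow> v (x - y) \<le> v w ^ m"
proof
  assume "res_class m x = res_class m y"
  moreover have "y \<in> res_class m y"
    by (simp add: res_class_def less_imp_le)
  ultimately have "y \<in> res_class m x"
    by simp
  then show "v (x - y) \<le> v w ^ m"
    by (simp add: res_class_def)
next
  assume "v (x - y) \<le> v w ^ m"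
  moreover from this have "v (y - x) \<le> v w ^ m"
    by (simp add: abs_diff_commute)
  ultimately show "res_class m x = res_class m y"
    unfolding res_class_def by (blast intro: abs_diff_trans)
qed

lemma residue_field_eq: "residue_field v = res_class 1 ` integers v"
proof -
  let ?r = "{(x, y). x \<in> integers v \<and> y \<in> integers v \<and> x - y \<in> max_ideal v}"
  have "?r `` {x} = res_class 1 x" if "x \<in> integers v" for x
  proof -
    have "v y \<le> 1" if "v (x - y) < 1" for y
      using abs_diff_le[of x "x - y"] that \<open>x \<in> integers v\<close> by (simp add: integers_iff)
    then show ?thesis
      using that abs_less_one_imp_le abs_uniformiser_less_one
      by (force simp: res_class_def integers_iff max_ideal_def)
  qed
  then show ?thesis
    by (auto simp: residue_field_def quotient_def)
qed

text \<open>Digit expansion: x = r + w y with r from a finite set of representatives modulo p, and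
  the class of x modulo p^(m+1) is the image of the class of y modulo p^m under z to r + w
  z.\<close>

lemma finite_res_classes: "finite (res_class m ` integers v)"
proof (induction m)
  case 0
  have "res_class 0 x = res_class 0 0" if "x \<in> integers v" for x
    using that by (simp add: res_class_eq_iff integers_iff)
  then have "res_class 0 ` integers v \<subseteq> {res_class 0 0}"
    by auto
  then show ?case
    by (rule finite_subset) simp
next
  case (Suc m)
  define R where "R = (\<lambda>C. SOME x. x \<in> C) ` residue_field v"
  have "res_class (Suc m) x \<in> (\<Union>r\<in>R. (\<lambda>C. (\<lambda>z. r + w * z) ` C) ` res_class m ` integers v)"
    if x: "x \<in> integers v" for x
  proof -
    define r where "r = (SOME y. y \<in> res_class 1 x)"
    have "x \<in> res_class 1 x"
      using abs_uniformiser_pos by (simp add: res_class_def)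
    then have "r \<in> res_class 1 x"
      unfolding r_def by (rule someI)
    then have r: "v (x - r) \<le> v w"
      by (simp add: res_class_def)
    have "r \<in> R"
      using x by (auto simp: R_def r_def residue_field_eq)
    define y where "y = (x - r) / w"
    have y: "y \<in> integers v" "x = r + w * y"
      using r abs_uniformiser_pos uniformiser_nonzero by (auto simp: y_def integers_iff abs_divide)
    have "res_class (Suc m) x = (\<lambda>z. r + w * z) ` res_class m y"
    proof (rule equalityI; rule subsetI)
      fix t assume t: "t \<in> res_class (Suc m) x"
      have "y - (t - r) / w = (x - t) / w"
        using uniformiser_nonzero by (simp add: y_def field_simps)
      then have "v (y - (t - r) / w) = v (x - t) / v w"
        by (simp add: abs_divide)
      then have "(t - r) / w \<in> res_class m y"
        using t abs_uniformiser_pos by (simp add: res_class_def divide_le_eq mult.commute)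
      then show "t \<in> (\<lambda>z. r + w * z) ` res_class m y"
        using uniformiser_nonzero by (intro image_eqI[of _ _ "(t - r) / w"]) auto
    next
      fix t assume "t \<in> (\<lambda>z. r + w * z) ` res_class m y"
      then obtain z where z: "v (y - z) \<le> v w ^ m" "t = r + w * z"
        by (auto simp: res_class_def)
      have "x - t = w * (y - z)"
        using y z by (simp add: algebra_simps)
      then show "t \<in> res_class (Suc m) x"
        using z abs_uniformiser_pos by (simp add: res_class_def mult)
    qed
    then show ?thesis
      using \<open>r \<in> R\<close> y by blast
  qed
  then have "res_class (Suc m) ` integers v
      \<subseteq> (\<Union>r\<in>R. (\<lambda>C. (\<lambda>z. r + w * z) ` C) ` res_class m ` integers v)"
    by blast
  moreover have "finite R"
    using finite_residue_field by (simp add: R_def)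
  then have "finite (\<Union>r\<in>R. (\<lambda>C. (\<lambda>z. r + w * z) ` C) ` res_class m ` integers v)"
    using Suc by blast
  ultimately show ?case
    by (rule finite_subset)
qed

end

subsection \<open>Haar measure and congruence cosets\<close>

locale haar_GL = nonarch_local_field v w for v :: "'a::field \<Rightarrow> real" and w :: 'a +
  fixes n :: nat and \<mu> :: "'a mat measure"
  assumes n_ge_2: "n \<ge> 2" and haar: "haar_probability v n \<mu>"
begin

text \<open>For k in the group this is the coset of the congruence subgroup of level m through k.
  That subgroup is normal, so left and right cosets agree, and congruence of entries expresses
  both.\<close>

definition coset :: "nat \<Rightarrow> 'a mat \<Rightarrow> 'a mat set" where
  "coset m k = {k' \<in> GL v n. \<forall>i<n. \<forall>j<n. v (k' $$ (i, j) - k $$ (i, j)) \<le> v w ^ m}"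

text \<open>Unions of cosets of the congruence subgroup of level m. For such sets measuring amounts
  to counting cosets.\<close>

definition coset_closed :: "nat \<Rightarrow> 'a mat set \<Rightarrow> bool" where
  "coset_closed m A \<longleftrightarrow> A \<subseteq> GL v n \<and> (\<forall>k\<in>A. coset m k \<subseteq> A)"

lemma n_pos: "n > 0"
  using n_ge_2 by simp

lemma space_haar: "space \<mu> = GL v n"
  using haar by (simp add: haar_probability_def)

lemma finite_measure_haar: "finite_measure \<mu>"
  using haar by (intro finite_measureI) (simp add: haar_probability_def)

lemma measure_GL: "measure \<mu> (GL v n) = 1"
  using haar by (simp add: haar_probability_def measure_def)

lemma coset_refl: "k \<in> GL v n \<Longrightarrow> k \<in> coset m k"
  by (simp add: coset_def less_imp_le)

lemma coset_subset_GL: "coset m k \<subseteq> GL v n"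
  by (auto simp: coset_def)

lemma coset_eq:
  assumes "k' \<in> coset m k"
  shows "coset m k' = coset m k"
proof -
  have "v (k $$ (i, j) - k' $$ (i, j)) \<le> v w ^ m" "v (k' $$ (i, j) - k $$ (i, j)) \<le> v w ^ m"
    if "i < n" "j < n" for i j
    using assms that abs_diff_commute by (auto simp: coset_def)
  then show ?thesis
    unfolding coset_def by (blast intro: abs_diff_trans)
qed

lemma coset_left:
  assumes g: "g \<in> GL v n" and k: "k \<in> GL v n" and k': "k' \<in> coset m k"
  shows "g * k' \<in> coset m (g * k)"
proof -
  have c: "g \<in> carrier_mat n n" "k \<in> carrier_mat n n" "k' \<in> carrier_mat n n" "k' \<in> GL v n"
    using g k k' GL_D(1) by (auto simp: coset_def)
  have "v ((g * k') $$ (i, j) - (g * k) $$ (i, j)) \<le> v w ^ m" if "i < n" "j < n" for i j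
  proof -
    have "(g * k') $$ (i, j) - (g * k) $$ (i, j) = (g * (k' - k)) $$ (i, j)"
      using that c by (simp add: mult_minus_distrib_mat[of g n n k' n k])
    also have "v \<dots> \<le> 1 * v w ^ m"
      using that c k' GL_D(2)[OF g]
      by (intro abs_mat_mult_le[of _ n n _ n]) (auto simp: coset_def less_imp_le)
    finally show ?thesis
      by simp
  qed
  then show ?thesis
    using GL_mult[OF g c(4)] by (simp add: coset_def)
qed

lemma coset_right:
  assumes g: "g \<in> GL v n" and k: "k \<in> GL v n" and k': "k' \<in> coset m k"
  shows "k' * g \<in> coset m (k * g)"
proof -
  have c: "g \<in> carrier_mat n n" "k \<in> carrier_mat n n" "k' \<in> carrier_mat n n" "k' \<in> GL v n"
    using g k k' GL_D(1) by (auto simp: coset_def)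
  have "v ((k' * g) $$ (i, j) - (k * g) $$ (i, j)) \<le> v w ^ m" if "i < n" "j < n" for i j
  proof -
    have "(k' * g) $$ (i, j) - (k * g) $$ (i, j) = ((k' - k) * g) $$ (i, j)"
      using that c by (simp add: minus_mult_distrib_mat[of k' n n k g n])
    also have "v \<dots> \<le> v w ^ m * 1"
      using that c k' GL_D(2)[OF g]
      by (intro abs_mat_mult_le[of _ n n _ n]) (auto simp: coset_def less_imp_le)
    finally show ?thesis
      by simp
  qed
  then show ?thesis
    using GL_mult[OF c(4) g] by (simp add: coset_def)
qed

lemma GL_cancel:
  assumes "g \<in> GL v n" "k \<in> carrier_mat n n"
  shows "g * (inv\<^bsub>mat_monoid v n\<^esub> g * k) = k" "inv\<^bsub>mat_monoid v n\<^esub> g * (g * k) = k"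
    "k * g * inv\<^bsub>mat_monoid v n\<^esub> g = k" "k * inv\<^bsub>mat_monoid v n\<^esub> g * g = k"
proof -
  let ?h = "inv\<^bsub>mat_monoid v n\<^esub> g"
  have c: "g \<in> carrier_mat n n" "?h \<in> carrier_mat n n"
    using GL_D(1)[OF assms(1)] GL_D(1)[OF GL_inv(1)[OF assms(1)]] by auto
  show "g * (?h * k) = k" "?h * (g * k) = k"
    using assms(2) c GL_inv[OF assms(1)] assoc_mult_mat[of g n n ?h n k n]
      assoc_mult_mat[of ?h n n g n k n] by simp_all
  show "k * g * ?h = k" "k * ?h * g = k"
    using assms(2) c GL_inv[OF assms(1)] assoc_mult_mat[of k n n g n ?h n]
      assoc_mult_mat[of k n n ?h n g n] by simp_all
qed

lemma image_left_coset:
  assumes g: "g \<in> GL v n" and k: "k \<in> GL v n"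
  shows "(\<lambda>x. g * x) ` coset m k = coset m (g * k)"
proof
  show "(\<lambda>x. g * x) ` coset m k \<subseteq> coset m (g * k)"
    using coset_left[OF g k] by auto
  show "coset m (g * k) \<subseteq> (\<lambda>x. g * x) ` coset m k"
  proof
    fix x assume x: "x \<in> coset m (g * k)"
    then have "inv\<^bsub>mat_monoid v n\<^esub> g * x \<in> coset m (inv\<^bsub>mat_monoid v n\<^esub> g * (g * k))"
      using coset_left[OF GL_inv(1)[OF g] GL_mult[OF g k]] by auto
    then show "x \<in> (\<lambda>x. g * x) ` coset m k"
      using GL_cancel(1)[OF g, of x] GL_cancel(2)[OF g GL_D(1)[OF k]] x GL_D(1)[of x n]
      by (intro image_eqI[of _ _ "inv\<^bsub>mat_monoid v n\<^esub> g * x"]) (auto simp: coset_def)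
  qed
qed

lemma image_right_coset:
  assumes g: "g \<in> GL v n" and k: "k \<in> GL v n"
  shows "(\<lambda>x. x * g) ` coset m k = coset m (k * g)"
proof
  show "(\<lambda>x. x * g) ` coset m k \<subseteq> coset m (k * g)"
    using coset_right[OF g k] by auto
  show "coset m (k * g) \<subseteq> (\<lambda>x. x * g) ` coset m k"
  proof
    fix x assume x: "x \<in> coset m (k * g)"
    then have "x * inv\<^bsub>mat_monoid v n\<^esub> g \<in> coset m (k * g * inv\<^bsub>mat_monoid v n\<^esub> g)"
      using coset_right[OF GL_inv(1)[OF g] GL_mult[OF k g]] by auto
    then show "x \<in> (\<lambda>x. x * g) ` coset m k"
      using GL_cancel(4)[OF g, of x] GL_cancel(3)[OF g GL_D(1)[OF k]] x GL_D(1)[of x n]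
      by (intro image_eqI[of _ _ "x * inv\<^bsub>mat_monoid v n\<^esub> g"]) (auto simp: coset_def)
  qed
qed

lemma finite_cosets: "finite (coset m ` GL v n)"
proof -
  let ?I = "{..<n} \<times> {..<n}"
  let ?G = "\<lambda>\<phi>. {k \<in> GL v n. \<forall>i<n. \<forall>j<n. res_class m (k $$ (i, j)) = \<phi> (i, j)}"
  have "coset m k \<in> ?G ` (?I \<rightarrow>\<^sub>E res_class m ` integers v)" if k: "k \<in> GL v n" for k
    using GL_D(2)[OF k]
    by (intro image_eqI[of _ _ "restrict (\<lambda>ij. res_class m (k $$ ij)) ?I"])
      (auto simp: coset_def res_class_eq_iff integers_iff)
  then have "coset m ` GL v n \<subseteq> ?G ` (?I \<rightarrow>\<^sub>E res_class m ` integers v)"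
    by blast
  then show ?thesis
    by (rule finite_subset) (intro finite_imageI finite_PiE finite_res_classes, auto)
qed

lemma coset_closed_coset: "coset_closed m (coset m k)"
  unfolding coset_closed_def using coset_eq coset_subset_GL by blast

text \<open>Around each of its points A contains all group elements at distance less than q^(-m), so
  it is relatively open and hence Borel.\<close>

lemma coset_closed_sets:
  assumes "coset_closed m A"
  shows "A \<in> sets \<mu>"
proof -
  interpret Metric_space "carrier_mat n n" "mat_dist v n"
    using n_pos by (rule Metric_space_mat)
  let ?T = "\<Union>k\<in>A. mball k (v w ^ m)"
  have "openin (mat_topology v n) ?T"
    unfolding mat_topology_def by blast
  moreover have "A = ?T \<inter> GL v n"
  proof
    show "A \<subseteq> ?T \<inter> GL v n"
      using assms GL_D(1) by (fastforce simp: coset_closed_def)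
    show "?T \<inter> GL v n \<subseteq> A"
    proof
      fix k' assume "k' \<in> ?T \<inter> GL v n"
      then obtain k where k: "k \<in> A" "mat_dist v n k k' < v w ^ m" "k' \<in> GL v n"
        by auto
      have "v (k $$ (i, j) - k' $$ (i, j)) \<le> mat_dist v n k k'" if "i < n" "j < n" for i j
        unfolding mat_dist_def using that by (intro Max_ge) auto
      then have "v (k' $$ (i, j) - k $$ (i, j)) \<le> v w ^ m" if "i < n" "j < n" for i j
        using k that by (metis abs_diff_commute less_imp_le order_trans)
      then have "k' \<in> coset m k"
        using k by (simp add: coset_def)
      then show "k' \<in> A"
        using assms k by (auto simp: coset_closed_def)
    qed
  qed
  ultimately have "openin (subtopology (mat_topology v n) (GL v n)) A"
    by (auto simp: openin_subtopology)
  then show ?thesis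
    using haar by (auto simp: haar_probability_def)
qed

lemma measure_coset:
  assumes "k \<in> GL v n"
  shows "measure \<mu> (coset m k) = measure \<mu> (coset m (1\<^sub>m n))"
proof -
  have "coset m (1\<^sub>m n) \<in> sets \<mu>"
    by (rule coset_closed_sets[OF coset_closed_coset])
  then have "emeasure \<mu> ((\<lambda>x. k * x) ` coset m (1\<^sub>m n)) = emeasure \<mu> (coset m (1\<^sub>m n))"
    using haar assms by (simp add: haar_probability_def)
  then show ?thesis
    using image_left_coset[OF assms GL_one] GL_D(1)[OF assms] by (simp add: measure_def)
qed

lemma Union_cosets: "coset_closed m A \<Longrightarrow> \<Union>(coset m ` A) = A"
  using coset_refl by (fastforce simp: coset_closed_def)

lemma disjoint_cosets: "disjoint_family_on (\<lambda>C. C) (coset m ` A)"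
  unfolding disjoint_family_on_def
proof (intro ballI impI)
  fix C D assume "C \<in> coset m ` A" "D \<in> coset m ` A" "C \<noteq> D"
  moreover have "coset m k = coset m l" if "x \<in> coset m k" "x \<in> coset m l" for x k l
    using coset_eq[OF that(1)] coset_eq[OF that(2)] by simp
  ultimately show "C \<inter> D = {}"
    by blast
qed

lemma measure_coset_closed:
  assumes "coset_closed m A"
  shows "measure \<mu> A = card (coset m ` A) * measure \<mu> (coset m (1\<^sub>m n))"
proof -
  interpret finite_measure \<mu> by (rule finite_measure_haar)
  have fin: "finite (coset m ` A)"
    using finite_cosets assms by (meson coset_closed_def finite_subset image_mono)
  have "measure \<mu> A = measure \<mu> (\<Union>C\<in>coset m ` A. C)"
    using Union_cosets[OF assms] by simp
  also have "\<dots> = (\<Sum>C\<in>coset m ` A. measure \<mu> C)"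
    using fin disjoint_cosets coset_closed_sets[OF coset_closed_coset]
    by (intro finite_measure_finite_Union) auto
  also have "\<dots> = (\<Sum>C\<in>coset m ` A. measure \<mu> (coset m (1\<^sub>m n)))"
    using assms by (intro sum.cong) (auto simp: coset_closed_def measure_coset)
  finally show ?thesis
    by simp
qed

text \<open>Finitely many cosets of equal measure share the total mass 1.\<close>

lemma measure_coset_pos: "measure \<mu> (coset m (1\<^sub>m n)) > 0"
proof -
  interpret finite_measure \<mu> by (rule finite_measure_haar)
  have "coset_closed m (GL v n)"
    by (auto simp: coset_closed_def coset_def)
  then have "card (coset m ` GL v n) * measure \<mu> (coset m (1\<^sub>m n)) = 1"
    using measure_coset_closed measure_GL by metis
  then show ?thesis
    by (auto simp: zero_less_measure_iff)
qed

text \<open>Right invariance is needed only for unions of cosets, where it follows from left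
  invariance because right translation permutes the finitely many cosets of the normal subgroup
  \<open>coset m 1\<close>.\<close>

lemma measure_right_translate:
  assumes A: "coset_closed m A" and g: "g \<in> GL v n"
  shows "measure \<mu> ((\<lambda>x. x * g) ` A) = measure \<mu> A"
proof -
  let ?R = "\<lambda>x. x * g"
  have sub: "A \<subseteq> GL v n"
    using A by (simp add: coset_closed_def)
  have eq: "coset m ` ?R ` A = image ?R ` coset m ` A"
    using sub image_right_coset[OF g] by (force simp: image_image)
  have "coset_closed m (?R ` A)"
    unfolding coset_closed_def
  proof (intro conjI ballI)
    show "?R ` A \<subseteq> GL v n"
      using sub GL_mult[OF _ g] by auto
    fix k assume "k \<in> ?R ` A"
    then obtain a where a: "a \<in> A" "k = a * g" by auto
    then have "coset m k = ?R ` coset m a"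
      using image_right_coset[OF g] sub by auto
    also have "\<dots> \<subseteq> ?R ` A"
      using A a by (auto simp: coset_closed_def)
    finally show "coset m k \<subseteq> ?R ` A" .
  qed
  moreover have "inj_on ?R (GL v n)"
    by (rule inj_on_inverseI[of _ "\<lambda>x. x * inv\<^bsub>mat_monoid v n\<^esub> g"])
      (use GL_cancel(3)[OF g] GL_D(1) in auto)
  then have "inj_on (image ?R) (coset m ` A)"
    by (rule inj_on_subset[OF inj_on_image_Pow]) (auto simp: coset_def)
  then have "card (coset m ` ?R ` A) = card (coset m ` A)"
    unfolding eq by (rule card_image)
  ultimately show ?thesis
    using A by (simp add: measure_coset_closed)
qed

text \<open>Such a G is a simple function: it takes one value on each of finitely many measurable
  cosets, and \<open>SOME\<close> picks the point at which that value is read off.\<close>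

lemma integral_coset_sum:
  fixes G :: "'a mat \<Rightarrow> complex"
  assumes G: "\<And>k k'. k \<in> GL v n \<Longrightarrow> k' \<in> coset m k \<Longrightarrow> G k' = G k"
  shows "(\<integral>k. G k \<partial>\<mu>) =
    (\<Sum>C\<in>coset m ` GL v n. measure \<mu> (coset m (1\<^sub>m n)) *\<^sub>R G (SOME k. k \<in> C))"
proof -
  interpret finite_measure \<mu> by (rule finite_measure_haar)
  let ?Q = "coset m ` GL v n"
  have "has_bochner_integral \<mu> (\<lambda>k. \<Sum>C\<in>?Q. indicator C k *\<^sub>R G (SOME k. k \<in> C))
      (\<Sum>C\<in>?Q. measure \<mu> C *\<^sub>R G (SOME k. k \<in> C))"
    using coset_closed_sets[OF coset_closed_coset]
    by (intro has_bochner_integral_sum has_bochner_integral_indicator)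
      (auto simp: emeasure_finite simp flip: less_top)
  moreover have "(\<Sum>C\<in>?Q. measure \<mu> C *\<^sub>R G (SOME k. k \<in> C))
      = (\<Sum>C\<in>?Q. measure \<mu> (coset m (1\<^sub>m n)) *\<^sub>R G (SOME k. k \<in> C))"
    by (intro sum.cong) (auto simp: measure_coset)
  moreover have "(\<integral>k. G k \<partial>\<mu>) = (\<integral>k. (\<Sum>C\<in>?Q. indicator C k *\<^sub>R G (SOME k. k \<in> C)) \<partial>\<mu>)"
  proof (rule Bochner_Integration.integral_cong[OF refl])
    fix k assume "k \<in> space \<mu>"
    then have k: "k \<in> GL v n"
      by (simp add: space_haar)
    then have "(SOME k'. k' \<in> coset m k) \<in> coset m k"
      using coset_refl by (intro someI)
    then have Gk: "G (SOME k'. k' \<in> coset m k) = G k"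
      using G k by blast
    have "(\<Sum>C\<in>?Q. indicator C k *\<^sub>R G (SOME k. k \<in> C))
        = (\<Sum>C\<in>?Q. if C = coset m k then G (SOME k. k \<in> C) else 0)"
      using k coset_eq coset_refl by (intro sum.cong refl) (auto simp: indicator_def)
    also have "\<dots> = G k"
      using k finite_cosets Gk by simp
    finally show "G k = (\<Sum>C\<in>?Q. indicator C k *\<^sub>R G (SOME k. k \<in> C))" ..
  qed
  ultimately show ?thesis
    by (simp add: has_bochner_integral_integral_eq)
qed

text \<open>The integral is a finite sum of nonnegative terms with positive weights, so each term
  vanishes. This gives vanishing at every point, not merely almost everywhere.\<close>

lemma integral_nonneg_eq_zero:
  fixes G :: "'a mat \<Rightarrow> real"
  assumes G: "\<And>k k'. k \<in> GL v n \<Longrightarrow> k' \<in> coset m k \<Longrightarrow> G k' = G k" and "\<And>k. 0 \<le> G k"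
    and 0: "(\<integral>k. complex_of_real (G k) \<partial>\<mu>) = 0" and k: "k \<in> GL v n"
  shows "G k = 0"
proof -
  let ?d = "measure \<mu> (coset m (1\<^sub>m n))"
  have "complex_of_real (\<Sum>C\<in>coset m ` GL v n. ?d * G (SOME k. k \<in> C)) = 0"
    using integral_coset_sum[of m "\<lambda>k. complex_of_real (G k)"] G 0 by (simp add: scaleR_conv_of_real)
  then have "(\<Sum>C\<in>coset m ` GL v n. ?d * G (SOME k. k \<in> C)) = 0"
    using of_real_eq_0_iff by blast
  then have "?d * G (SOME k'. k' \<in> coset m k) = 0"
    using assms(2) k finite_cosets by (subst (asm) sum_nonneg_eq_0_iff) auto
  then have "G (SOME k'. k' \<in> coset m k) = 0"
    using measure_coset_pos[of m] by auto
  moreover have "(SOME k'. k' \<in> coset m k) \<in> coset m k"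
    using coset_refl[OF k] by (rule someI)
  ultimately show ?thesis
    using G k by metis
qed

end

subsection \<open>The induced measure on the sphere\<close>

context haar_GL
begin

definition sphere_ball :: "nat \<Rightarrow> 'a vec \<Rightarrow> 'a vec set" where
  "sphere_ball m x = {y \<in> unit_sphere v n. \<forall>i<n. v (y $ i - x $ i) \<le> v w ^ m}"

definition ball_closed :: "nat \<Rightarrow> 'a vec set \<Rightarrow> bool" where
  "ball_closed m A \<longleftrightarrow> A \<subseteq> unit_sphere v n \<and> (\<forall>x\<in>A. sphere_ball m x \<subseteq> A)"

text \<open>The image of Haar measure under k to e_n k, kept as a plain set function because it is
  evaluated only on unions of congruence classes.\<close>

definition sphere_measure :: "'a vec set \<Rightarrow> real" where
  "sphere_measure A = measure \<mu> {k \<in> GL v n. e_last n \<bullet>\<^sub>r k \<in> A}"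

text \<open>For j > 0 these are the points congruent modulo p^j to a unit multiple of e_n, and for j
  = 0 they form the whole sphere. Differences of consecutive sets are the shells M = q^(-j).\<close>

definition head_ball :: "nat \<Rightarrow> 'a vec set" where
  "head_ball j = {x \<in> unit_sphere v n. sup_abs v (n - 1) x \<le> v w ^ j}"

lemma e_last_in_sphere: "e_last n \<in> unit_sphere v n"
  using e_last_sphere n_pos by blast

lemma sphere_mult_GL: "x \<in> unit_sphere v n \<Longrightarrow> k \<in> GL v n \<Longrightarrow> x \<bullet>\<^sub>r k \<in> unit_sphere v n"
  using unit_sphere_row_mult n_pos by blast

lemma sphere_mult_cancel:
  assumes "g \<in> GL v n" "x \<in> unit_sphere v n"
  shows "x \<bullet>\<^sub>r g \<bullet>\<^sub>r inv\<^bsub>mat_monoid v n\<^esub> g = x" "x \<bullet>\<^sub>r inv\<^bsub>mat_monoid v n\<^esub> g \<bullet>\<^sub>r g = x"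
proof -
  let ?h = "inv\<^bsub>mat_monoid v n\<^esub> g"
  have c: "g \<in> carrier_mat n n" "?h \<in> carrier_mat n n" "x \<in> carrier_vec n"
    using assms GL_D(1) GL_inv(1) by (auto simp: unit_sphere_iff)
  then show "x \<bullet>\<^sub>r g \<bullet>\<^sub>r ?h = x" "x \<bullet>\<^sub>r ?h \<bullet>\<^sub>r g = x"
    using row_mult_assoc[of g n n ?h n x] row_mult_assoc[of ?h n n g n x] GL_inv[OF assms(1)]
    by simp_all
qed

lemma sphere_transitive:
  assumes "x \<in> unit_sphere v n" "y \<in> unit_sphere v n"
  shows "\<exists>k \<in> GL v n. x \<bullet>\<^sub>r k = y"
proof -
  have "v (y $ i - x $ i) \<le> 1" if "i < n" for i
    using abs_diff_le[of "y $ i" "x $ i"] unit_sphere_abs_le[OF _ that] assms by (smt (verit))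
  then show ?thesis
    using sphere_orbit[OF n_pos assms, of 1] by auto
qed

lemma sphere_ball_refl: "x \<in> unit_sphere v n \<Longrightarrow> x \<in> sphere_ball m x"
  by (simp add: sphere_ball_def less_imp_le)

lemma sphere_ball_eq:
  assumes "y \<in> sphere_ball m x"
  shows "sphere_ball m y = sphere_ball m x"
proof -
  have "v (x $ i - y $ i) \<le> v w ^ m" "v (y $ i - x $ i) \<le> v w ^ m" if "i < n" for i
    using assms that abs_diff_commute by (auto simp: sphere_ball_def)
  then show ?thesis
    unfolding sphere_ball_def by (blast intro: abs_diff_trans)
qed

lemma sphere_ball_mult:
  assumes "x \<in> unit_sphere v n" "y \<in> sphere_ball m x" "g \<in> GL v n"
  shows "y \<bullet>\<^sub>r g \<in> sphere_ball m (x \<bullet>\<^sub>r g)"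
proof -
  have c: "g \<in> carrier_mat n n" "x \<in> carrier_vec n" "y \<in> carrier_vec n"
    using assms GL_D(1) by (auto simp: unit_sphere_iff sphere_ball_def)
  have "v ((y \<bullet>\<^sub>r g) $ j - (x \<bullet>\<^sub>r g) $ j) \<le> v w ^ m" if j: "j < n" for j
  proof -
    have "(y \<bullet>\<^sub>r g) $ j - (x \<bullet>\<^sub>r g) $ j = ((y - x) \<bullet>\<^sub>r g) $ j"
      using c j by (simp add: row_mult_index left_diff_distrib sum_subtractf)
    also have "v \<dots> \<le> v w ^ m * 1"
      using c j assms GL_D(2)[OF assms(3)]
      by (intro row_mult_abs_le[of _ n n]) (auto simp: sphere_ball_def less_imp_le)
    finally show ?thesis
      by simp
  qed
  then show ?thesis
    using assms sphere_mult_GL by (auto simp: sphere_ball_def)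
qed

lemma sphere_mult_coset:
  assumes "x \<in> unit_sphere v n" "k \<in> GL v n" "k' \<in> coset m k"
  shows "x \<bullet>\<^sub>r k' \<in> sphere_ball m (x \<bullet>\<^sub>r k)"
proof -
  have c: "k \<in> carrier_mat n n" "k' \<in> carrier_mat n n" "k' \<in> GL v n" "x \<in> carrier_vec n"
    using assms GL_D(1) by (auto simp: unit_sphere_iff coset_def)
  have "v ((x \<bullet>\<^sub>r k') $ j - (x \<bullet>\<^sub>r k) $ j) \<le> v w ^ m" if j: "j < n" for j
  proof -
    have "(x \<bullet>\<^sub>r k') $ j - (x \<bullet>\<^sub>r k) $ j = (x \<bullet>\<^sub>r (k' - k)) $ j"
      using c j minus_carrier_mat[of k n n k']
      by (simp add: row_mult_index right_diff_distrib sum_subtractf)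
    also have "v \<dots> \<le> 1 * v w ^ m"
      using c j assms unit_sphere_abs_le[OF assms(1)] minus_carrier_mat[of k n n k']
      by (intro row_mult_abs_le[of _ n n]) (auto simp: coset_def less_imp_le)
    finally show ?thesis
      by simp
  qed
  then show ?thesis
    using assms(1) c sphere_mult_GL by (auto simp: sphere_ball_def)
qed

lemma image_sphere_ball:
  assumes g: "g \<in> GL v n" and x: "x \<in> unit_sphere v n"
  shows "(\<lambda>x. x \<bullet>\<^sub>r g) ` sphere_ball m x = sphere_ball m (x \<bullet>\<^sub>r g)"
proof
  show "(\<lambda>x. x \<bullet>\<^sub>r g) ` sphere_ball m x \<subseteq> sphere_ball m (x \<bullet>\<^sub>r g)"
    using sphere_ball_mult[OF x _ g] by auto
  show "sphere_ball m (x \<bullet>\<^sub>r g) \<subseteq> (\<lambda>x. x \<bullet>\<^sub>r g) ` sphere_ball m x"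
  proof
    fix y assume y: "y \<in> sphere_ball m (x \<bullet>\<^sub>r g)"
    then have "y \<bullet>\<^sub>r inv\<^bsub>mat_monoid v n\<^esub> g \<in> sphere_ball m x"
      using sphere_ball_mult[OF sphere_mult_GL[OF x g] y GL_inv(1)[OF g]]
        sphere_mult_cancel[OF g x] by simp
    then show "y \<in> (\<lambda>x. x \<bullet>\<^sub>r g) ` sphere_ball m x"
      using sphere_mult_cancel(2)[OF g, of y] y
      by (intro image_eqI[of _ _ "y \<bullet>\<^sub>r inv\<^bsub>mat_monoid v n\<^esub> g"]) (auto simp: sphere_ball_def)
  qed
qed

lemma ball_closed_ball: "ball_closed m (sphere_ball m x)"
proof -
  have "sphere_ball m x \<subseteq> unit_sphere v n"
    by (auto simp: sphere_ball_def)
  then show ?thesis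
    unfolding ball_closed_def using sphere_ball_eq by blast
qed

lemma ball_closed_translate:
  assumes A: "ball_closed m A" and g: "g \<in> GL v n"
  shows "ball_closed m ((\<lambda>x. x \<bullet>\<^sub>r g) ` A)"
proof -
  have "(\<lambda>x. x \<bullet>\<^sub>r g) ` A \<subseteq> unit_sphere v n"
    using A sphere_mult_GL[OF _ g] by (auto simp: ball_closed_def)
  moreover have "sphere_ball m (x \<bullet>\<^sub>r g) \<subseteq> (\<lambda>x. x \<bullet>\<^sub>r g) ` A" if "x \<in> A" for x
  proof -
    have "sphere_ball m (x \<bullet>\<^sub>r g) = (\<lambda>x. x \<bullet>\<^sub>r g) ` sphere_ball m x"
      using A that image_sphere_ball[OF g] by (auto simp: ball_closed_def)
    moreover have "sphere_ball m x \<subseteq> A"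
      using A that by (simp add: ball_closed_def)
    ultimately show ?thesis
      by blast
  qed
  ultimately show ?thesis
    by (auto simp: ball_closed_def)
qed

lemma coset_closed_preimage:
  assumes "ball_closed m A"
  shows "coset_closed m {k \<in> GL v n. e_last n \<bullet>\<^sub>r k \<in> A}"
  unfolding coset_closed_def
proof (intro conjI ballI subsetI)
  fix k k' assume "k \<in> {k \<in> GL v n. e_last n \<bullet>\<^sub>r k \<in> A}" "k' \<in> coset m k"
  then show "k' \<in> {k \<in> GL v n. e_last n \<bullet>\<^sub>r k \<in> A}"
    using assms sphere_mult_coset[OF e_last_in_sphere, of k k' m] coset_subset_GL
    by (auto simp: ball_closed_def)
qed auto

text \<open>The preimage in the group of the translate A g is the right translate by g of the
  preimage of A. This is where right invariance of the measure enters.\<close>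

lemma sphere_measure_translate:
  assumes A: "ball_closed m A" and g: "g \<in> GL v n"
  shows "sphere_measure ((\<lambda>x. x \<bullet>\<^sub>r g) ` A) = sphere_measure A"
proof -
  let ?h = "inv\<^bsub>mat_monoid v n\<^esub> g"
  have assoc: "e_last n \<bullet>\<^sub>r (k * l) = e_last n \<bullet>\<^sub>r k \<bullet>\<^sub>r l" if "k \<in> GL v n" "l \<in> GL v n" for k l
    using row_mult_assoc[of k n n l n "e_last n"] that GL_D(1) by (auto simp: e_last_def)
  have "{k \<in> GL v n. e_last n \<bullet>\<^sub>r k \<in> (\<lambda>x. x \<bullet>\<^sub>r g) ` A}
      = (\<lambda>k. k * g) ` {k \<in> GL v n. e_last n \<bullet>\<^sub>r k \<in> A}" (is "?L = ?R")
  proof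
    show "?R \<subseteq> ?L"
      using GL_mult[OF _ g] g by (auto simp: assoc)
    show "?L \<subseteq> ?R"
    proof
      fix k assume "k \<in> ?L"
      then obtain x where x: "k \<in> GL v n" "x \<in> A" "e_last n \<bullet>\<^sub>r k = x \<bullet>\<^sub>r g"
        by auto
      then have "e_last n \<bullet>\<^sub>r (k * ?h) = x"
        using assoc[OF x(1) GL_inv(1)[OF g]] sphere_mult_cancel[OF g, of x] A
        by (auto simp: ball_closed_def)
      then show "k \<in> ?R"
        using x GL_mult[OF x(1) GL_inv(1)[OF g]] GL_cancel(4)[OF g GL_D(1)[OF x(1)]]
        by (intro image_eqI[of _ _ "k * ?h"]) auto
    qed
  qed
  then show ?thesis
    using measure_right_translate[OF coset_closed_preimage[OF A] g] by (simp add: sphere_measure_def)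
qed

lemma sphere_measure_sphere: "sphere_measure (unit_sphere v n) = 1"
proof -
  have "{k \<in> GL v n. e_last n \<bullet>\<^sub>r k \<in> unit_sphere v n} = GL v n"
    using sphere_mult_GL[OF e_last_in_sphere] by auto
  then show ?thesis
    by (simp add: sphere_measure_def measure_GL)
qed

lemma sphere_measure_ball:
  assumes "x \<in> unit_sphere v n"
  shows "sphere_measure (sphere_ball m x) = sphere_measure (sphere_ball m (e_last n))"
proof -
  obtain g where "g \<in> GL v n" "e_last n \<bullet>\<^sub>r g = x"
    using sphere_transitive[OF e_last_in_sphere assms] by blast
  then show ?thesis
    using image_sphere_ball[of g "e_last n" m] sphere_measure_translate[OF ball_closed_ball, of g m]
      e_last_in_sphere by metis
qed

lemma sphere_measure_pos:
  assumes "ball_closed m A" "x \<in> A"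
  shows "sphere_measure A > 0"
proof -
  interpret finite_measure \<mu> by (rule finite_measure_haar)
  obtain k where k: "k \<in> GL v n" "e_last n \<bullet>\<^sub>r k = x"
    using sphere_transitive[OF e_last_in_sphere, of x] assms by (auto simp: ball_closed_def)
  have "coset m k \<subseteq> {k \<in> GL v n. e_last n \<bullet>\<^sub>r k \<in> A}"
    using coset_closed_preimage[OF assms(1)] k assms by (auto simp: coset_closed_def)
  then have "measure \<mu> (coset m k) \<le> sphere_measure A"
    unfolding sphere_measure_def
    by (intro finite_measure_mono coset_closed_sets[OF coset_closed_preimage[OF assms(1)]])
  then show ?thesis
    using measure_coset_pos[of m] measure_coset[OF k(1), of m] by simp
qed

text \<open>The counting principle behind all volumes: the labels f split A into finitely many
  pieces of equal measure. The labels will be residue classes of coordinates or of their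
  ratios.\<close>

lemma sphere_measure_fibres:
  fixes d :: real
  assumes "finite (f ` A)"
    and "\<And>t. t \<in> f ` A \<Longrightarrow> ball_closed m {x \<in> A. f x = t}"
    and "\<And>t. t \<in> f ` A \<Longrightarrow> sphere_measure {x \<in> A. f x = t} = d"
  shows "sphere_measure A = card (f ` A) * d"
proof -
  interpret finite_measure \<mu> by (rule finite_measure_haar)
  let ?P = "\<lambda>B. {k \<in> GL v n. e_last n \<bullet>\<^sub>r k \<in> B}"
  have "?P A = (\<Union>t\<in>f ` A. ?P {x \<in> A. f x = t})"
    by auto
  then have "sphere_measure A = measure \<mu> (\<Union>t\<in>f ` A. ?P {x \<in> A. f x = t})"
    by (simp add: sphere_measure_def)
  also have "\<dots> = (\<Sum>t\<in>f ` A. measure \<mu> (?P {x \<in> A. f x = t}))"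
    using assms(1) coset_closed_sets[OF coset_closed_preimage[OF assms(2)]]
    by (intro finite_measure_finite_Union) (auto simp: disjoint_family_on_def)
  also have "\<dots> = (\<Sum>t\<in>f ` A. d)"
    using assms(3) by (intro sum.cong refl) (simp add: sphere_measure_def)
  finally show ?thesis
    by simp
qed

section \<open>Volumes of the sets \<open>head_ball j\<close>\<close>

lemma ball_closed_head_ball:
  assumes "j \<le> m"
  shows "ball_closed m (head_ball j)"
  unfolding ball_closed_def
proof (intro conjI ballI subsetI)
  fix x y assume x: "x \<in> head_ball j" and y: "y \<in> sphere_ball m x"
  have "v (x $ i - y $ i) \<le> v w ^ j" if "i < n - 1" for i
  proof -
    have "v (y $ i - x $ i) \<le> v w ^ m"
      using y that by (simp add: sphere_ball_def)
    then show ?thesis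
      using powers_antimono[OF assms] abs_diff_commute[of "x $ i" "y $ i"] by simp
  qed
  then show "y \<in> head_ball j"
    using sup_abs_cong(1)[of "n - 1" x y "v w ^ j"] x y n_ge_2 by (auto simp: head_ball_def sphere_ball_def)
qed (auto simp: head_ball_def)

text \<open>The first n - 1 coordinates are non-units, yet some coordinate of a point of the sphere
  has absolute value 1.\<close>

lemma head_ball_last:
  assumes "x \<in> head_ball j" "j > 0"
  shows "v (x $ (n - 1)) = 1"
proof -
  have x: "sup_abs v n x = 1" "sup_abs v (n - 1) x < 1"
    using assms powers_less_one[of j] by (auto simp: head_ball_def unit_sphere_iff)
  obtain i where i: "i < n" "v (x $ i) = 1"
    using sup_abs_attained[OF n_pos, of x] x by metis
  then have "\<not> i < n - 1"
    using abs_le_sup_abs[of i "n - 1" x] x by auto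
  then have "i = n - 1"
    using i by auto
  then show ?thesis
    using i by simp
qed

lemma head_ball_0: "head_ball 0 = unit_sphere v n"
  using n_ge_2 unit_sphere_abs_le by (auto simp: head_ball_def sup_abs_le_iff)

lemma scalar_prod_e_last: "x \<in> carrier_vec n \<Longrightarrow> scalar_prod x (e_last n) = x $ (n - 1)"
  using n_pos by (simp add: e_last_def)

text \<open>The label f records the ratios x_i / x_n at scale w^j modulo p; x_n is a unit because j
  > 0. The matrix fixes x_n and adds x_n u_i to x_i, so it shifts every ratio by the corresponding
  ratio of x0. It therefore carries the fibre with all labels zero, which is
  \<open>head_ball (Suc j)\<close>, onto the fibre of x0.\<close>

lemma head_ball_fibre:
  assumes x0: "x0 \<in> head_ball j" and j: "j > 0"
  defines "u \<equiv> vec n (\<lambda>i. if i < n - 1 then x0 $ i / x0 $ (n - 1) else 0)"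
  defines "f \<equiv> \<lambda>x. restrict (\<lambda>i. res_class 1 (x $ i / (x $ (n - 1) * w ^ j))) {..<n - 1}"
  shows "rank_one n (e_last n) u \<in> GL v n"
    and "{x \<in> head_ball j. f x = f x0} = (\<lambda>x. x \<bullet>\<^sub>r rank_one n (e_last n) u) ` head_ball (Suc j)"
proof -
  have v0: "v (x0 $ (n - 1)) = 1"
    using head_ball_last[OF x0 j] .
  have x0i: "v (x0 $ i) \<le> v w ^ j" if "i < n - 1" for i
    using x0 abs_le_sup_abs[OF that, of x0] by (simp add: head_ball_def)
  have carr: "x \<in> carrier_vec n" if "x \<in> head_ball i" for x i
    using that by (simp add: head_ball_def unit_sphere_iff)
  have e: "e_last n \<in> carrier_vec n" "\<And>i. i < n \<Longrightarrow> v (e_last n $ i) \<le> 1"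
    by (auto simp: e_last_def abs_one)
  have u: "u \<in> carrier_vec n" "- u \<in> carrier_vec n"
    by (auto simp: u_def)
  have ui: "v (u $ i) \<le> v w ^ j" if "i < n" for i
    using that x0i[of i] v0 by (auto simp: u_def abs_divide less_imp_le)
  then have ui1: "v (u $ i) \<le> 1" if "i < n" for i
    using that powers_le_one[of j] by (meson order_trans)
  have un: "u $ (n - 1) = 0"
    using n_pos by (simp add: u_def)
  show g: "rank_one n (e_last n) u \<in> GL v n"
    using e u ui1 un by (intro rank_one_GL) (auto simp: scalar_prod_e_last abs_one)
  have h: "rank_one n (e_last n) (- u) \<in> GL v n"
    using e u ui1 un n_pos by (intro rank_one_GL) (auto simp: scalar_prod_e_last abs_one abs_minus)
  have move: "(x \<bullet>\<^sub>r rank_one n (e_last n) u) $ i = x $ i + x $ (n - 1) * u $ i"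
    "(x \<bullet>\<^sub>r rank_one n (e_last n) (- u)) $ i = x $ i - x $ (n - 1) * u $ i"
    if "x \<in> carrier_vec n" "i < n" for x i
    using that u by (simp_all add: row_mult_rank_one[OF that(1) e(1)] scalar_prod_e_last)
  have f_eq: "f x = f x0 \<longleftrightarrow> (\<forall>i<n - 1. v (x $ i - x $ (n - 1) * u $ i) \<le> v w ^ Suc j)"
    if x: "v (x $ (n - 1)) = 1" for x
  proof -
    have "v (x $ i / (x $ (n - 1) * w ^ j) - x0 $ i / (x0 $ (n - 1) * w ^ j)) \<le> v w ^ 1 \<longleftrightarrow>
        v (x $ i - x $ (n - 1) * u $ i) \<le> v w ^ Suc j" if i: "i < n - 1" for i
    proof -
      have nz: "x $ (n - 1) \<noteq> 0" "x0 $ (n - 1) \<noteq> 0" "w ^ j \<noteq> 0"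
        using x v0 uniformiser_nonzero by auto
      have "x $ i - x $ (n - 1) * u $ i = x $ (n - 1) * w ^ j *
          (x $ i / (x $ (n - 1) * w ^ j) - x0 $ i / (x0 $ (n - 1) * w ^ j))"
        using i nz uniformiser_nonzero by (simp add: u_def right_diff_distrib)
      then have "v (x $ i - x $ (n - 1) * u $ i) = v w ^ j *
          v (x $ i / (x $ (n - 1) * w ^ j) - x0 $ i / (x0 $ (n - 1) * w ^ j))"
        using x by (simp only: mult abs_power)
      then show ?thesis
        using powers_pos[of j] by (simp add: mult.commute)
    qed
    then show ?thesis
      unfolding f_def fun_eq_iff restrict_def
      by (auto simp: res_class_eq_iff)
  qed
  show "{x \<in> head_ball j. f x = f x0}
      = (\<lambda>x. x \<bullet>\<^sub>r rank_one n (e_last n) u) ` head_ball (Suc j)" (is "?L = ?g ` _")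
  proof
    show "?L \<subseteq> ?g ` head_ball (Suc j)"
    proof
      fix x assume x: "x \<in> ?L"
      let ?y = "x \<bullet>\<^sub>r rank_one n (e_last n) (- u)"
      have xc: "x \<in> carrier_vec n" "x \<in> unit_sphere v n" "v (x $ (n - 1)) = 1"
        using x carr head_ball_last[OF _ j] by (auto simp: head_ball_def)
      have "?y \<in> head_ball (Suc j)"
        using x f_eq[OF xc(3)] sphere_mult_GL[OF xc(2) h] n_ge_2 xc(1)
        by (simp add: head_ball_def sup_abs_le_iff move)
      moreover have "?g ?y = x"
      proof (rule eq_vecI)
        fix i assume "i < dim_vec x"
        then show "?g ?y $ i = x $ i"
          using xc(1) un n_pos by (simp add: move row_mult_carrier[OF rank_one_carrier])
      qed (use xc(1) in \<open>auto simp: rank_one_def\<close>)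
      ultimately show "x \<in> ?g ` head_ball (Suc j)"
        by (metis image_eqI)
    qed
    show "?g ` head_ball (Suc j) \<subseteq> ?L"
    proof
      fix y assume "y \<in> ?g ` head_ball (Suc j)"
      then obtain x where x: "x \<in> head_ball (Suc j)" "y = ?g x"
        by auto
      have xc: "x \<in> carrier_vec n" "x \<in> unit_sphere v n" "v (x $ (n - 1)) = 1"
        using x(1) carr[OF x(1)] head_ball_last[of x "Suc j"] by (auto simp: head_ball_def)
      have xi: "v (x $ i) \<le> v w ^ Suc j" if "i < n - 1" for i
        using x abs_le_sup_abs[OF that, of x] by (simp add: head_ball_def)
      have yn: "y $ (n - 1) = x $ (n - 1)"
        using x xc un n_pos by (simp add: move)
      have "v (y $ i) \<le> v w ^ j" if "i < n - 1" for i
      proof -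
        have "v (x $ i) \<le> v w ^ j"
          by (rule order_trans[OF xi[OF that] powers_antimono]) simp
        moreover have "v (x $ (n - 1) * u $ i) \<le> v w ^ j"
          using xc ui[of i] that by (simp add: mult)
        ultimately show ?thesis
          using ultrametric[of "x $ i" "x $ (n - 1) * u $ i"] x xc that by (simp add: move)
      qed
      then have "y \<in> head_ball j"
        using sphere_mult_GL[OF xc(2) g] x n_ge_2 by (simp add: head_ball_def sup_abs_le_iff)
      moreover have "y $ i - y $ (n - 1) * u $ i = x $ i" if "i < n - 1" for i
        unfolding yn using x xc that by (simp add: move)
      then have "f y = f x0"
        using f_eq[of y] yn xc xi by simp
      ultimately show "y \<in> ?L"
        by simp
    qed
  qed
qed

lemma head_ball_labels:
  assumes j: "j > 0"
  shows "(\<lambda>x. restrict (\<lambda>i. res_class 1 (x $ i / (x $ (n - 1) * w ^ j))) {..<n - 1}) ` head_ball j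
    = ({..<n - 1} \<rightarrow>\<^sub>E residue_field v)" (is "?f ` _ = _")
proof
  show "?f ` head_ball j \<subseteq> ({..<n - 1} \<rightarrow>\<^sub>E residue_field v)"
  proof clarify
    fix x assume x: "x \<in> head_ball j"
    have "v (x $ i / (x $ (n - 1) * w ^ j)) \<le> 1" if "i < n - 1" for i
      using x abs_le_sup_abs[OF that, of x] head_ball_last[OF x j]
      by (simp add: head_ball_def abs_divide mult abs_power)
    then show "?f x \<in> {..<n - 1} \<rightarrow>\<^sub>E residue_field v"
      by (auto simp: residue_field_eq integers_iff)
  qed
  show "({..<n - 1} \<rightarrow>\<^sub>E residue_field v) \<subseteq> ?f ` head_ball j"
  proof
    fix \<phi> assume \<phi>: "\<phi> \<in> {..<n - 1} \<rightarrow>\<^sub>E residue_field v"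
    then have "\<forall>i\<in>{..<n - 1}. \<exists>r\<in>integers v. \<phi> i = res_class 1 r"
      by (force simp: residue_field_eq PiE_iff)
    then obtain r where r: "\<And>i. i < n - 1 \<Longrightarrow> v (r i) \<le> 1 \<and> \<phi> i = res_class 1 (r i)"
      unfolding integers_iff Bex_def by (metis lessThan_iff)
    \<comment> \<open>With last coordinate 1, the labels are the classes of the head coordinates
      divided by w^j, so scaling the lifts r i by w^j realises the prescribed classes.\<close>
    define x where "x = vec n (\<lambda>i. if i < n - 1 then w ^ j * r i else 1)"
    have xi: "v (x $ i) \<le> v w ^ j" if "i < n - 1" for i
      using r[OF that] that by (simp add: x_def mult abs_power)
    have xn: "x $ (n - 1) = 1"
      using n_pos by (simp add: x_def)
    have "v (x $ i) \<le> 1" if "i < n" for i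
    proof (cases "i < n - 1")
      case True
      then show ?thesis
        using xi powers_le_one order_trans by blast
    qed (use that in \<open>simp add: x_def abs_one\<close>)
    then have "sup_abs v n x = 1"
      using n_pos abs_le_sup_abs[of "n - 1" n x] xn
      by (intro antisym) (auto simp: sup_abs_le_iff abs_one)
    then have "x \<in> head_ball j"
      using xi n_ge_2 by (auto simp: head_ball_def unit_sphere_iff sup_abs_le_iff x_def)
    moreover have "?f x = \<phi>"
    proof (rule PiE_ext[of _ "{..<n - 1}" "\<lambda>_. UNIV"])
      fix i assume "i \<in> {..<n - 1}"
      then show "?f x i = \<phi> i"
        using r[of i] xn uniformiser_nonzero by (simp add: x_def)
    qed (use \<phi> in auto)
    ultimately show "\<phi> \<in> ?f ` head_ball j"
      by blast
  qed
qed

text \<open>All q^(n-1) labels occur, and each fibre is a translate of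
  \<open>head_ball (Suc j)\<close>.\<close>

lemma sphere_measure_head_ball_Suc:
  assumes j: "j > 0"
  shows "sphere_measure (head_ball j)
    = real (residue_order v) ^ (n - 1) * sphere_measure (head_ball (Suc j))"
proof -
  let ?f = "\<lambda>x. restrict (\<lambda>i. res_class 1 (x $ i / (x $ (n - 1) * w ^ j))) {..<n - 1}"
  have "sphere_measure (head_ball j)
      = card (?f ` head_ball j) * sphere_measure (head_ball (Suc j))"
  proof (rule sphere_measure_fibres[of _ _ "Suc j"])
    show "finite (?f ` head_ball j)"
      unfolding head_ball_labels[OF j] using finite_residue_field by (intro finite_PiE) auto
  next
    fix t assume "t \<in> ?f ` head_ball j"
    then obtain x0 where "x0 \<in> head_ball j" "t = ?f x0"
      by auto
    note x0 = this(1) head_ball_fibre[OF this(1) j] this(2)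
    show "ball_closed (Suc j) {x \<in> head_ball j. ?f x = t}"
      unfolding x0(3,4) by (intro ball_closed_translate ball_closed_head_ball x0(2)) simp
    show "sphere_measure {x \<in> head_ball j. ?f x = t} = sphere_measure (head_ball (Suc j))"
      unfolding x0(3,4)
      by (intro sphere_measure_translate[of "Suc j"] ball_closed_head_ball x0(2)) simp
  qed
  then show ?thesis
    unfolding head_ball_labels[OF j] by (simp add: card_PiE residue_order_def)
qed

text \<open>Reduction modulo p maps the sphere onto the q^n - 1 nonzero vectors over the residue
  field, and \<open>head_ball 1\<close> onto the q - 1 of them whose first n - 1 coordinates vanish.
  In both cases the fibres are balls of level 1, which all have the measure
  \<open>?d\<close>.\<close>

lemma sphere_measure_head_ball_1:
  "(real (residue_order v) ^ n - 1) * sphere_measure (head_ball 1) = real (residue_order v) - 1"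
proof -
  let ?d = "sphere_measure (sphere_ball 1 (e_last n))" and ?q = "residue_order v"
  let ?f = "\<lambda>x. restrict (\<lambda>i. res_class 1 (x $ i)) {..<n}"
  let ?z = "restrict (\<lambda>i. res_class 1 0) {..<n}"
  have fin: "finite ({..<n} \<rightarrow>\<^sub>E residue_field v)"
    using finite_residue_field by (intro finite_PiE) auto
  have z: "?z \<in> {..<n} \<rightarrow>\<^sub>E residue_field v" "res_class 1 0 \<in> residue_field v"
    by (auto simp: residue_field_eq integers_iff)
  have nonunit: "res_class 1 t = res_class 1 0 \<longleftrightarrow> v t < 1" for t
    using abs_less_one_imp_le[of t] abs_uniformiser_less_one by (auto simp: res_class_eq_iff)
  have labels: "?f ` unit_sphere v n = ({..<n} \<rightarrow>\<^sub>E residue_field v) - {?z}"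
  proof
    show "?f ` unit_sphere v n \<subseteq> ({..<n} \<rightarrow>\<^sub>E residue_field v) - {?z}"
    proof clarify
      fix x assume x: "x \<in> unit_sphere v n"
      obtain i where i: "i < n" "v (x $ i) = 1"
        using sup_abs_attained[OF n_pos, of x] x by (metis unit_sphere_iff)
      have "?f x i \<noteq> ?z i"
        using i nonunit[of "x $ i"] by simp
      then have "?f x \<noteq> ?z"
        by metis
      moreover have "?f x \<in> {..<n} \<rightarrow>\<^sub>E residue_field v"
        using unit_sphere_abs_le[OF x] by (auto simp: residue_field_eq integers_iff)
      ultimately show "?f x \<in> ({..<n} \<rightarrow>\<^sub>E residue_field v) - {?z}"
        by blast
    qed
    show "({..<n} \<rightarrow>\<^sub>E residue_field v) - {?z} \<subseteq> ?f ` unit_sphere v n"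
    proof
      fix \<phi> assume \<phi>: "\<phi> \<in> ({..<n} \<rightarrow>\<^sub>E residue_field v) - {?z}"
      then have "\<forall>i\<in>{..<n}. \<exists>r\<in>integers v. \<phi> i = res_class 1 r"
        by (force simp: residue_field_eq PiE_iff)
      then obtain r where r: "\<And>i. i < n \<Longrightarrow> v (r i) \<le> 1 \<and> \<phi> i = res_class 1 (r i)"
        unfolding integers_iff Bex_def by (metis lessThan_iff)
      have fr: "?f (vec n r) = \<phi>"
      proof (rule PiE_ext[of _ "{..<n}" "\<lambda>_. UNIV"])
        fix i assume "i \<in> {..<n}"
        then show "?f (vec n r) i = \<phi> i"
          using r[of i] by simp
      qed (use \<phi> in auto)
      have "\<exists>i<n. v (r i) = 1"
      proof (rule ccontr)
        assume "\<not> ?thesis"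
        then have "v (r i) < 1" if "i < n" for i
          using r[OF that] that by fastforce
        then have "?f (vec n r) = ?z"
          using nonunit by (intro restrict_ext) simp
        then show False
          using \<phi> fr by auto
      qed
      then obtain i where "i < n" "v (r i) = 1"
        by blast
      then have "sup_abs v n (vec n r) = 1"
        using r abs_le_sup_abs[of i n "vec n r"] n_pos
        by (intro antisym) (auto simp: sup_abs_le_iff)
      then show "\<phi> \<in> ?f ` unit_sphere v n"
        using fr by (intro image_eqI[of _ _ "vec n r"]) (auto simp: unit_sphere_iff)
    qed
  qed
  have fibre: "{x \<in> unit_sphere v n. ?f x = ?f x0} = sphere_ball 1 x0" for x0
    unfolding fun_eq_iff restrict_def
    by (auto simp: sphere_ball_def res_class_eq_iff)
  have "sphere_measure (unit_sphere v n) = card (?f ` unit_sphere v n) * ?d"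
  proof (rule sphere_measure_fibres[of _ _ 1])
    show "finite (?f ` unit_sphere v n)"
      unfolding labels using fin by blast
  next
    fix t assume "t \<in> ?f ` unit_sphere v n"
    then obtain x0 where x0: "x0 \<in> unit_sphere v n" "t = ?f x0"
      by auto
    show "ball_closed 1 {x \<in> unit_sphere v n. ?f x = t}"
      unfolding x0(2) fibre by (rule ball_closed_ball)
    show "sphere_measure {x \<in> unit_sphere v n. ?f x = t} = ?d"
      unfolding x0(2) fibre by (rule sphere_measure_ball[OF x0(1)])
  qed
  moreover have "real (card (?f ` unit_sphere v n)) = real ?q ^ n - 1"
    unfolding labels using fin z(1) residue_order_ge_2
    by (simp add: card_Diff_singleton card_PiE of_nat_diff flip: residue_order_def)
  ultimately have 1: "(real ?q ^ n - 1) * ?d = 1"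
    by (simp add: sphere_measure_sphere)
  \<comment> \<open>On \<open>head_ball 1\<close> the other coordinates vanish modulo p, so the last
    coordinate alone determines the ball of level 1.\<close>
  let ?l = "\<lambda>x. res_class 1 (x $ (n - 1))"
  have llabels: "?l ` head_ball 1 = residue_field v - {res_class 1 0}"
  proof
    show "?l ` head_ball 1 \<subseteq> residue_field v - {res_class 1 0}"
      using head_ball_last[of _ 1] nonunit by (fastforce simp: residue_field_eq integers_iff)
    show "residue_field v - {res_class 1 0} \<subseteq> ?l ` head_ball 1"
    proof
      fix C assume "C \<in> residue_field v - {res_class 1 0}"
      then obtain t where t: "C = res_class 1 t" "v t \<le> 1" "res_class 1 t \<noteq> res_class 1 0"
        unfolding residue_field_eq integers_def by blast
      then have "\<not> v t < 1"
        using nonunit by blast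
      with t have "v t = 1" by simp
      then have s: "t \<cdot>\<^sub>v e_last n \<in> unit_sphere v n"
        by (rule unit_sphere_smult[OF e_last_in_sphere])
      have "(t \<cdot>\<^sub>v e_last n) $ (n - 1) = t" "\<And>i. i < n - 1 \<Longrightarrow> (t \<cdot>\<^sub>v e_last n) $ i = 0"
        using n_pos by (auto simp: e_last_def)
      then show "C \<in> ?l ` head_ball 1"
        using t s n_ge_2 abs_uniformiser_pos
        by (intro image_eqI[of _ _ "t \<cdot>\<^sub>v e_last n"]) (auto simp: head_ball_def sup_abs_le_iff)
    qed
  qed
  have lfibre: "{x \<in> head_ball 1. ?l x = ?l x0} = sphere_ball 1 x0" if x0: "x0 \<in> head_ball 1" for x0
  proof
    show "sphere_ball 1 x0 \<subseteq> {x \<in> head_ball 1. ?l x = ?l x0}"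
      using ball_closed_head_ball[of 1 1] x0 n_pos
      by (auto simp: ball_closed_def res_class_eq_iff sphere_ball_def)
    show "{x \<in> head_ball 1. ?l x = ?l x0} \<subseteq> sphere_ball 1 x0"
    proof clarify
      fix x assume x: "x \<in> head_ball 1" "?l x = ?l x0"
      have "v (x $ i - x0 $ i) \<le> v w ^ 1" if i: "i < n" for i
      proof (cases "i = n - 1")
        case True
        then show ?thesis
          using x(2) by (simp add: res_class_eq_iff)
      next
        case False
        then have "i < n - 1"
          using i by simp
        then have "v (x $ i) \<le> v w ^ 1" "v (x0 $ i) \<le> v w ^ 1"
          using x(1) x0 n_ge_2 by (auto simp: head_ball_def sup_abs_le_iff)
        then show ?thesis
          using abs_diff_le[of "x $ i" "x0 $ i"] by simp
      qed
      then show "x \<in> sphere_ball 1 x0"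
        using x by (simp add: sphere_ball_def head_ball_def)
    qed
  qed
  have "sphere_measure (head_ball 1) = card (?l ` head_ball 1) * ?d"
  proof (rule sphere_measure_fibres[of _ _ 1])
    show "finite (?l ` head_ball 1)"
      unfolding llabels using finite_residue_field by blast
  next
    fix t assume "t \<in> ?l ` head_ball 1"
    then obtain x0 where x0: "x0 \<in> head_ball 1" "t = ?l x0"
      by auto
    show "ball_closed 1 {x \<in> head_ball 1. ?l x = t}"
      unfolding x0(2) lfibre[OF x0(1)] by (rule ball_closed_ball)
    show "sphere_measure {x \<in> head_ball 1. ?l x = t} = ?d"
      unfolding x0(2) lfibre[OF x0(1)] using x0(1) by (intro sphere_measure_ball) (simp add: head_ball_def)
  qed
  moreover have "real (card (?l ` head_ball 1)) = real ?q - 1"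
    unfolding llabels using finite_residue_field z(2) residue_order_ge_2
    by (simp add: card_Diff_singleton of_nat_diff flip: residue_order_def)
  ultimately have "sphere_measure (head_ball 1) = (real ?q - 1) * ?d"
    by simp
  then have "(real ?q ^ n - 1) * sphere_measure (head_ball 1)
      = (real ?q - 1) * ((real ?q ^ n - 1) * ?d)"
    by simp
  then show ?thesis
    unfolding 1 by simp
qed

text \<open>The orthogonality relation is linear in a, with nonzero slope because the shell M =
  q^(1-m) has positive measure.\<close>

lemma zonal_coeff_unique:
  assumes m: "m > 0"
  shows "complex_of_real (sphere_measure (head_ball m)) + a *
      complex_of_real (sphere_measure (head_ball (m - 1)) - sphere_measure (head_ball m)) = 0
    \<longleftrightarrow> a = complex_of_real (zonal_coeff (residue_order v) n m)"
proof -
  let ?q = "real (residue_order v)"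
  let ?V = "sphere_measure (head_ball m)" and ?W = "sphere_measure (head_ball (m - 1))"
  have q: "?q > 1"
    using residue_order_ge_2 by simp
  then have qn: "?q ^ (n - 1) > 1"
    using n_ge_2 by (intro one_less_power) auto
  have "e_last n \<in> head_ball m"
    using n_ge_2 e_last_in_sphere by (auto simp: head_ball_def sup_abs_le_iff e_last_def less_imp_le)
  then have V: "?V > 0"
    using sphere_measure_pos[OF ball_closed_head_ball[of m m]] by blast
  have "?W - ?V > 0 \<and> ?V + zonal_coeff (residue_order v) n m * (?W - ?V) = 0"
  proof (cases "m = 1")
    case True
    have W: "?W = 1"
      using True sphere_measure_sphere by (simp add: head_ball_0)
    have qq: "?q ^ n = ?q * ?q ^ (n - 1)"
      using n_pos by (metis Suc_diff_1 power_Suc)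
    have "?q * ?q ^ (n - 1) > 1"
      using q qn by (simp add: less_1_mult)
    then have Veq: "?V = (?q - 1) / (?q * ?q ^ (n - 1) - 1)"
      using sphere_measure_head_ball_1 True by (simp add: qq field_simps)
    have "?W - ?V = ?q * (?q ^ (n - 1) - 1) / (?q * ?q ^ (n - 1) - 1)"
      unfolding W Veq using \<open>?q * ?q ^ (n - 1) > 1\<close> by (simp add: field_simps)
    then show ?thesis
      using q qn \<open>?q * ?q ^ (n - 1) > 1\<close> True unfolding Veq zonal_coeff_def
      by (simp flip: add_divide_distrib)
  next
    case False
    then have "?W = ?q ^ (n - 1) * ?V"
      using sphere_measure_head_ball_Suc[of "m - 1"] m by simp
    then have "?W - ?V = (?q ^ (n - 1) - 1) * ?V"
      by (simp add: algebra_simps)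
    then show ?thesis
      using False V qn by (simp add: zonal_coeff_def)
  qed
  then have W: "?W - ?V > 0" and Z: "?V + zonal_coeff (residue_order v) n m * (?W - ?V) = 0"
    by auto
  have "complex_of_real ?V = - of_real (zonal_coeff (residue_order v) n m) * of_real (?W - ?V)"
    using Z by (metis add_eq_0_iff2 mult_minus_left of_real_minus of_real_mult)
  then have "complex_of_real ?V + a * of_real (?W - ?V)
      = (a - of_real (zonal_coeff (residue_order v) n m)) * of_real (?W - ?V)"
    by (simp add: algebra_simps)
  then show ?thesis
    using W by auto
qed

text \<open>The inner products evaluated in the existence and the uniqueness argument have
  integrands of this shape: the phases of chi cancel, which leaves one constant on each of the two
  regions.\<close>

lemma integral_head_balls:
  assumes F: "\<And>x. x \<in> unit_sphere v n \<Longrightarrow> F x =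
      (if x \<in> head_ball m then a else if x \<in> head_ball (m - 1) then b else (0 :: complex))"
  shows "(\<integral>k. F (e_last n \<bullet>\<^sub>r k) \<partial>\<mu>) = a * of_real (sphere_measure (head_ball m)) +
    b * of_real (sphere_measure (head_ball (m - 1)) - sphere_measure (head_ball m))"
proof -
  interpret finite_measure \<mu> by (rule finite_measure_haar)
  let ?P = "\<lambda>j. {k \<in> GL v n. e_last n \<bullet>\<^sub>r k \<in> head_ball j}"
  have sets: "?P m \<in> sets \<mu>" "?P (m - 1) \<in> sets \<mu>"
    by (rule coset_closed_sets[OF coset_closed_preimage[OF ball_closed_head_ball[of _ m]]]; simp)+
  have sub: "?P m \<subseteq> ?P (m - 1)"
    using powers_antimono[of "m - 1" m] by (auto simp: head_ball_def)
  have "has_bochner_integral \<mu>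
      (\<lambda>k. indicator (?P m) k *\<^sub>R a + indicator (?P (m - 1) - ?P m) k *\<^sub>R b)
      (measure \<mu> (?P m) *\<^sub>R a + measure \<mu> (?P (m - 1) - ?P m) *\<^sub>R b)"
    using sets by (intro has_bochner_integral_add has_bochner_integral_indicator)
      (auto simp: emeasure_finite simp flip: less_top)
  moreover have "(\<integral>k. F (e_last n \<bullet>\<^sub>r k) \<partial>\<mu>)
      = (\<integral>k. (indicator (?P m) k *\<^sub>R a + indicator (?P (m - 1) - ?P m) k *\<^sub>R b) \<partial>\<mu>)"
    using sub F sphere_mult_GL[OF e_last_in_sphere]
    by (intro Bochner_Integration.integral_cong) (auto simp: space_haar indicator_def)
  moreover have "measure \<mu> (?P (m - 1) - ?P m) = measure \<mu> (?P (m - 1)) - measure \<mu> (?P m)"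
    using finite_measure_Diff[OF sets(2,1) sub] .
  ultimately show ?thesis
    by (simp add: has_bochner_integral_integral_eq sphere_measure_def scaleR_conv_of_real mult.commute)
qed

end

subsection \<open>Characters of the unit group\<close>

locale haar_character = haar_GL v w n \<mu>
  for v :: "'a::field \<Rightarrow> real" and w :: 'a and n :: nat and \<mu> :: "'a mat measure" +
  fixes chi :: "'a \<Rightarrow> complex"
  assumes character: "unit_character v chi"
begin

lemma chi_mult: "v x = 1 \<Longrightarrow> v y = 1 \<Longrightarrow> chi (x * y) = chi x * chi y"
  using character by (simp add: unit_character_def integer_units_iff)

lemma chi_nonzero:
  assumes "v x = 1"
  shows "chi x \<noteq> 0"
proof -
  interpret Metric_space UNIV "field_dist v"
    by (rule Metric_space_field)
  have "x \<in> topspace (subtopology (field_topology v) (integer_units v))"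
    using assms by (simp add: field_topology_def integer_units_iff)
  moreover have "continuous_map (subtopology (field_topology v) (integer_units v)) (top_of_set (- {0})) chi"
    using character by (simp add: unit_character_def)
  ultimately have "chi x \<in> topspace (top_of_set (- {0}))"
    using continuous_map_image_subset_topspace by blast
  then show ?thesis
    by simp
qed

lemma chi_one: "chi 1 = 1"
  using chi_mult[of 1 1] chi_nonzero[of 1] by (simp add: abs_one)

lemma chi_power: "v x = 1 \<Longrightarrow> chi (x ^ k) = chi x ^ k"
  by (induction k) (auto simp: chi_one chi_mult abs_power)

text \<open>Continuity at 1, with the neighbourhood shrunk to a member of the filtration. The radius
  1/2 leaves room for a squaring argument.\<close>

lemma chi_near_one: "\<exists>N. \<forall>u \<in> unit_filtration v w N. cmod (chi u - 1) < 1 / 2"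
proof -
  interpret Metric_space UNIV "field_dist v"
    by (rule Metric_space_field)
  let ?X = "subtopology (field_topology v) (integer_units v)"
  let ?U = "{x \<in> topspace ?X. chi x \<in> - {0} \<inter> ball 1 (1 / 2)}"
  have "continuous_map ?X (top_of_set (- {0})) chi"
    using character by (simp add: unit_character_def)
  then have "openin ?X ?U"
    by (rule openin_continuous_map_preimage) (rule openin_open_Int, simp)
  then obtain T where T: "openin mtopology T" "?U = T \<inter> integer_units v"
    unfolding openin_subtopology field_topology_def by blast
  have "1 \<in> ?U"
    using chi_one by (simp add: field_topology_def integer_units_iff abs_one)
  then have "1 \<in> T"
    unfolding T(2) by blast
  then obtain r where r: "r > 0" "mball 1 r \<subseteq> T"
    using T(1) by (auto simp: openin_mtopology)
  obtain N where N: "v w ^ N < r"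
    using real_arch_pow_inv[OF r(1) abs_uniformiser_less_one] by blast
  have "cmod (chi u - 1) < 1 / 2" if "u \<in> unit_filtration v w N" for u
  proof -
    have "v u = 1" "field_dist v 1 u < r"
      using that N by (auto simp: unit_filtration_iff field_dist_def abs_diff_commute[of 1 u])
    then have "u \<in> T \<inter> integer_units v"
      using r(2) by (auto simp: integer_units_iff)
    then have "u \<in> ?U"
      unfolding T(2) .
    then have "chi u \<in> ball 1 (1 / 2)"
      by blast
    then show ?thesis
      by (simp add: dist_norm norm_minus_commute)
  qed
  then show ?thesis
    by blast
qed

text \<open>No small subgroups: if \<open>z\<close> and all its iterated squares lie within \<open>1 / 2\<close> of \<open>1\<close>, then
  squaring expands the distance to \<open>1\<close> by a factor of at least \<open>3 / 2\<close>.\<close>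

lemma chi_trivial_near_one: "\<exists>N. \<forall>u \<in> unit_filtration v w N. chi u = 1"
proof -
  obtain N where N: "\<And>u. u \<in> unit_filtration v w N \<Longrightarrow> cmod (chi u - 1) < 1 / 2"
    using chi_near_one by blast
  have sq: "u * u \<in> unit_filtration v w N" if "u \<in> unit_filtration v w N" for u
  proof -
    have "v (u * (u - 1)) \<le> v w ^ N" "v (u - 1) \<le> v w ^ N"
      using that by (auto simp: unit_filtration_iff mult)
    then have "v (u * u - 1) \<le> v w ^ N"
      using ultrametric[of "u * (u - 1)" "u - 1"] by (simp add: algebra_simps)
    then show ?thesis
      using that by (simp add: unit_filtration_iff mult)
  qed
  have grow: "(3 / 2) ^ k * cmod (chi u - 1) \<le> 1 / 2" if "u \<in> unit_filtration v w N" for u k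
    using that
  proof (induction k arbitrary: u)
    case 0
    then show ?case
      using N by (simp add: less_imp_le)
  next
    case (Suc k)
    let ?z = "chi u"
    have "2 - cmod (?z - 1) \<le> cmod (?z + 1)"
      using norm_triangle_ineq2[of 2 "1 - ?z"] by (simp add: norm_minus_commute add.commute)
    then have "3 / 2 \<le> cmod (?z + 1)"
      using N[OF Suc.prems] by simp
    then have "3 / 2 * cmod (?z - 1) \<le> cmod (?z + 1) * cmod (?z - 1)"
      by (rule mult_right_mono) simp
    also have "\<dots> = cmod (chi (u * u) - 1)"
      using Suc.prems by (simp add: chi_mult unit_filtration_iff algebra_simps flip: norm_mult)
    finally have "(3 / 2) ^ k * (3 / 2 * cmod (?z - 1)) \<le> (3 / 2) ^ k * cmod (chi (u * u) - 1)"
      by (rule mult_left_mono) simp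
    then have "(3 / 2) ^ k * (3 / 2 * cmod (?z - 1)) \<le> 1 / 2"
      using Suc.IH[OF sq[OF Suc.prems]] by linarith
    then show ?case
      by (simp add: mult_ac)
  qed
  have "chi u = 1" if u: "u \<in> unit_filtration v w N" for u
  proof (rule ccontr)
    assume "chi u \<noteq> 1"
    then have pos: "cmod (chi u - 1) > 0"
      by simp
    obtain k where "(1 / 2) / cmod (chi u - 1) < (3 / 2 :: real) ^ k"
      using real_arch_pow[of "3 / 2"] by auto
    then have "1 / 2 < (3 / 2) ^ k * cmod (chi u - 1)"
      using pos by (simp add: field_simps)
    then show False
      using grow[OF u, of k] by simp
  qed
  then show ?thesis
    by blast
qed

section \<open>The conductor and the extended character\<close>

abbreviation cond :: nat where
  "cond \<equiv> conductor v w chi"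

abbreviation cv :: "'a \<Rightarrow> complex" where
  "cv \<equiv> char_value v chi"

text \<open>The least exponent is attained because chi is trivial on some member of the
  filtration.\<close>

lemma chi_conductor: "u \<in> unit_filtration v w cond \<Longrightarrow> chi u = 1"
  using LeastI_ex[OF chi_trivial_near_one] unfolding conductor_def by blast

lemma chi_below_conductor: "j < cond \<Longrightarrow> \<exists>u \<in> unit_filtration v w j. chi u \<noteq> 1"
  using not_less_Least[of j "\<lambda>m. \<forall>u \<in> unit_filtration v w m. chi u = 1"] unfolding conductor_def by blast

text \<open>Level 0 of the filtration is the whole unit group, so chi is trivial precisely when its
  conductor exponent is 0. The convention for the trivial character thereby becomes a case
  distinction on \<open>cond\<close>.\<close>

lemma cv_eq: "cv y = (if cond = 0 then 1 else chi y)"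
proof (cases "cond = 0")
  case True
  then show ?thesis
    using chi_conductor by (simp add: char_value_def unit_filtration_def)
next
  case False
  then have "\<exists>u \<in> integer_units v. chi u \<noteq> 1"
    using chi_below_conductor[of 0] by (simp add: unit_filtration_def)
  then show ?thesis
    using False by (auto simp: char_value_def)
qed

lemma chi_eq_one: "cond = 0 \<Longrightarrow> v y = 1 \<Longrightarrow> chi y = 1"
  using chi_conductor[of y] by (simp add: unit_filtration_iff) (use abs_diff_le[of y 1] in \<open>simp add: abs_one\<close>)

text \<open>By the pigeonhole principle two distinct powers of u agree modulo p^cond. Their
  quotient, a positive power of u, lies in the kernel of chi, so chi u is a root of unity.\<close>

lemma chi_norm:
  assumes u: "v u = 1"
  shows "cmod (chi u) = 1"
proof -
  let ?f = "\<lambda>k. res_class cond (u ^ k)"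
  have "range ?f \<subseteq> res_class cond ` integers v"
    using u by (auto simp: integers_iff abs_power)
  then have "finite (range ?f)"
    using finite_res_classes finite_subset by blast
  then have "\<not> inj ?f"
    using range_inj_infinite by blast
  then obtain a b where ab: "a \<noteq> b" "?f a = ?f b"
    by (auto simp: inj_def)
  have *: "cmod (chi u) = 1" if "a < b" "v (u ^ a - u ^ b) \<le> v w ^ cond" for a b
  proof -
    have "u ^ b = u ^ a * u ^ (b - a)"
      using that by (simp flip: power_add)
    then have "u ^ a - u ^ b = u ^ a * (1 - u ^ (b - a))"
      by (simp add: right_diff_distrib)
    then have "v (u ^ (b - a) - 1) \<le> v w ^ cond"
      using that(2) u abs_diff_commute[of 1 "u ^ (b - a)"] by (simp add: mult abs_power)
    then have "chi u ^ (b - a) = 1"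
      using chi_conductor[of "u ^ (b - a)"] u by (simp add: unit_filtration_iff abs_power chi_power)
    then show ?thesis
      using that(1) power_eq_1_iff[of "chi u" "b - a"] by simp
  qed
  show ?thesis
    using ab *[of a b] *[of b a] abs_diff_commute[of "u ^ a" "u ^ b"]
    by (auto simp: res_class_eq_iff neq_iff)
qed

lemma cv_cnj:
  assumes "cond = 0 \<or> v y = 1"
  shows "cv y * cnj (cv y) = 1"
  using assms chi_norm[of y] by (auto simp: cv_eq complex_norm_square[symmetric])

lemma cv_mult:
  assumes "cond = 0 \<or> v y = 1" "v a = 1"
  shows "cv (a * y) = chi a * cv y"
  using assms chi_mult[of a y] chi_eq_one[of a] by (auto simp: cv_eq)

lemma cv_one: "cv 1 = 1"
  by (simp add: cv_eq chi_one)

text \<open>If chi is nontrivial, x and hence y are units and y / x is congruent to 1 modulo p^cond.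
  If chi is trivial, the convention makes the value constantly 1.\<close>

lemma cv_close:
  assumes "cond = 0 \<or> v x = 1" "v (y - x) \<le> v w ^ cond"
  shows "cv y = cv x"
proof (cases "cond = 0")
  case False
  then have x: "v x = 1" "x \<noteq> 0"
    using assms by auto
  have "v (x - y) < v x"
    unfolding x(1) abs_diff_commute[of x y] using assms(2) powers_less_one[of cond] False by linarith
  then have y: "v y = 1"
    using abs_eq_of_diff[of x y] x(1) by metis
  have "y / x - 1 = (y - x) / x"
    using x(2) by (simp add: diff_divide_distrib)
  then have "v (y / x - 1) = v (y - x)"
    by (simp only: abs_divide x(1) div_by_1)
  then have "chi (y / x) = 1"
    using assms(2) x(1) y by (intro chi_conductor) (simp add: unit_filtration_iff abs_divide)
  then have "chi y = chi x"
    using chi_mult[of "y / x" x] x y by (simp add: abs_divide)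
  then show ?thesis
    by (simp add: cv_eq)
qed (simp add: cv_eq)

text \<open>The guard under which \<open>cv\<close> is multiplicative and unimodular: the last
  coordinate can be a non-unit only for j = 0, and then chi is trivial.\<close>

lemma head_ball_unit: "x \<in> head_ball j \<Longrightarrow> cond \<le> j \<Longrightarrow> cond = 0 \<or> v (x $ (n - 1)) = 1"
  using head_ball_last[of x j] by auto

subsection \<open>Zonal functions\<close>

text \<open>By the orbit description, invariance under the congruence subgroup is the same as
  invariance under congruence of points. Local constancy then comes for free, since each congruence
  class contains an open ball around each of its points.\<close>

lemma level_space_iff:
  "f \<in> level_space v w n chi m \<longleftrightarrow> f \<in> extensional (unit_sphere v n) \<and>
    (\<forall>x \<in> unit_sphere v n. \<forall>y \<in> sphere_ball m x. f y = f x) \<and>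
    (\<forall>a x. v a = 1 \<longrightarrow> x \<in> unit_sphere v n \<longrightarrow> f (a \<cdot>\<^sub>v x) = chi a * f x)"
    (is "_ \<longleftrightarrow> ?ext \<and> ?ball \<and> ?equiv")
proof
  assume f: "f \<in> level_space v w n chi m"
  have ?ball
  proof (intro ballI)
    fix x y assume x: "x \<in> unit_sphere v n" and y: "y \<in> sphere_ball m x"
    then obtain k where k: "k \<in> GL v n" "x \<bullet>\<^sub>r k = y"
      "\<forall>i<n. \<forall>j<n. v (k $$ (i, j) - 1\<^sub>m n $$ (i, j)) \<le> v w ^ m"
      using sphere_orbit[OF n_pos x, of y "v w ^ m"] by (auto simp: sphere_ball_def)
    then have "k \<in> congruence_subgroup v w n m"
      unfolding congruence_subgroup_iff by blast
    then have "f (x \<bullet>\<^sub>r k) = f x"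
      using f x by (simp add: level_space_def)
    then show "f y = f x"
      using k by simp
  qed
  then show "?ext \<and> ?ball \<and> ?equiv"
    using f by (auto simp: level_space_def loc_const_def integer_units_iff)
next
  assume f: "?ext \<and> ?ball \<and> ?equiv"
  have "f \<in> loc_const v n"
    unfolding loc_const_def
  proof (intro CollectI conjI ballI)
    interpret Metric_space "carrier_vec n" "vec_dist v n"
      using n_pos by (rule Metric_space_vec)
    fix x assume x: "x \<in> unit_sphere v n"
    let ?U = "mball x (v w ^ m) \<inter> unit_sphere v n"
    have "openin (subtopology (vec_topology v n) (unit_sphere v n)) ?U"
      by (auto simp: openin_subtopology vec_topology_def)
    moreover have "x \<in> ?U"
      using x by (simp add: unit_sphere_iff)
    moreover have "?U \<subseteq> sphere_ball m x"
    proof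
      fix y assume y: "y \<in> ?U"
      have "v (x $ i - y $ i) \<le> vec_dist v n x y" if "i < n" for i
        unfolding vec_dist_def using that by (intro Max_ge) auto
      then have "v (y $ i - x $ i) \<le> v w ^ m" if "i < n" for i
        using y that abs_diff_commute[of "y $ i" "x $ i"] by fastforce
      then show "y \<in> sphere_ball m x"
        using y by (simp add: sphere_ball_def)
    qed
    then have "\<forall>y\<in>?U. f y = f x"
      using f x by blast
    ultimately show "\<exists>U. openin (subtopology (vec_topology v n) (unit_sphere v n)) U \<and> x \<in> U \<and>
        (\<forall>y\<in>U. f y = f x)"
      by blast
  qed (use f in blast)
  moreover have "f (x \<bullet>\<^sub>r k) = f x"
    if "k \<in> congruence_subgroup v w n m" "x \<in> unit_sphere v n" for k x
  proof -
    have "k \<in> coset m (1\<^sub>m n)"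
      using that(1) unfolding congruence_subgroup_iff coset_def by blast
    then have "x \<bullet>\<^sub>r k \<in> sphere_ball m x"
      using sphere_mult_coset[OF that(2) GL_one] that(2) by (simp add: unit_sphere_iff)
    then show ?thesis
      using f that by blast
  qed
  ultimately show "f \<in> level_space v w n chi m"
    using f unfolding level_space_def by (auto simp: integer_units_iff)
qed

lemma level_spaceD:
  assumes "f \<in> level_space v w n chi m"
  shows "x \<in> unit_sphere v n \<Longrightarrow> y \<in> sphere_ball m x \<Longrightarrow> f y = f x"
    and "v a = 1 \<Longrightarrow> x \<in> unit_sphere v n \<Longrightarrow> f (a \<cdot>\<^sub>v x) = chi a * f x"
  using assms unfolding level_space_iff by blast+

text \<open>For j > 0 the point x is congruent to x_n e_n modulo p^j, and equivariance extracts
  chi(x_n). For j = 0 all points of the sphere are congruent and chi is trivial, so f is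
  constant.\<close>

lemma level_space_head_ball:
  assumes f: "f \<in> level_space v w n chi j" and j: "cond \<le> j" and x: "x \<in> head_ball j"
  shows "f x = cv (x $ (n - 1)) * f (e_last n)"
proof (cases "j = 0")
  case True
  have "v (x $ i - e_last n $ i) \<le> 1" if "i < n" for i
    using abs_diff_le[of "x $ i" "e_last n $ i"] unit_sphere_abs_le[OF _ that, of x]
      unit_sphere_abs_le[OF e_last_in_sphere that] x by (simp add: head_ball_def)
  then have "x \<in> sphere_ball j (e_last n)"
    using x True by (simp add: sphere_ball_def head_ball_def)
  then show ?thesis
    using level_spaceD(1)[OF f e_last_in_sphere] True j by (simp add: cv_eq)
next
  case False
  let ?t = "x $ (n - 1)"
  have t: "v ?t = 1"
    using head_ball_last[OF x] False by simp
  have xS: "x \<in> unit_sphere v n"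
    using x by (simp add: head_ball_def)
  have "v (x $ i - (?t \<cdot>\<^sub>v e_last n) $ i) \<le> v w ^ j" if "i < n" for i
  proof (cases "i = n - 1")
    case False
    then have "i < n - 1"
      using that by simp
    then show ?thesis
      using that x abs_le_sup_abs[of i "n - 1" x] by (auto simp: e_last_def head_ball_def)
  qed (use n_pos in \<open>auto simp: e_last_def less_imp_le\<close>)
  then have "x \<in> sphere_ball j (?t \<cdot>\<^sub>v e_last n)"
    using xS by (simp add: sphere_ball_def)
  then have "f x = f (?t \<cdot>\<^sub>v e_last n)"
    using level_spaceD(1)[OF f unit_sphere_smult[OF e_last_in_sphere t]] by blast
  also have "\<dots> = chi ?t * f (e_last n)"
    using level_spaceD(2)[OF f t e_last_in_sphere] .
  also have "chi ?t = cv ?t"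
    using t chi_eq_one by (simp add: cv_eq)
  finally show ?thesis .
qed

lemma sup_abs_smult:
  assumes "N \<le> dim_vec x" "v a = 1"
  shows "sup_abs v N (a \<cdot>\<^sub>v x) = sup_abs v N x"
  unfolding sup_abs_def using assms by (intro arg_cong[of _ _ Max] image_cong) (auto simp: mult)

lemma head_ball_smult:
  assumes "x \<in> unit_sphere v n" "v a = 1"
  shows "a \<cdot>\<^sub>v x \<in> head_ball j \<longleftrightarrow> x \<in> head_ball j"
proof -
  have "n - 1 \<le> dim_vec x"
    using assms by (auto simp: unit_sphere_iff dest: carrier_vecD)
  then show ?thesis
    using assms unit_sphere_smult by (simp add: head_ball_def sup_abs_smult)
qed

lemma head_ball_sphere_ball:
  assumes "x \<in> unit_sphere v n" "y \<in> sphere_ball m x" "j \<le> m"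
  shows "y \<in> head_ball j \<longleftrightarrow> x \<in> head_ball j"
proof -
  have "x \<in> sphere_ball m y"
    using sphere_ball_eq[OF assms(2)] sphere_ball_refl[OF assms(1)] by simp
  then show ?thesis
    using ball_closed_head_ball[OF assms(3)] assms(2) by (auto simp: ball_closed_def)
qed

lemma head_ball_antimono: "i \<le> j \<Longrightarrow> head_ball j \<subseteq> head_ball i"
  using powers_antimono[of i j] by (auto simp: head_ball_def)

lemma head_ball_sphere: "x \<in> head_ball j \<Longrightarrow> x \<in> unit_sphere v n"
  by (simp add: head_ball_def)

text \<open>In block form the first n - 1 coordinates are acted on by an element of the smaller
  group, which preserves their maximum, and the last coordinate gains their pairing with the
  integral column b. Together with \<open>mirabolic_orbit\<close> this determines the orbits
  wherever M > 0.\<close>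

lemma mirabolic_action:
  assumes k: "k \<in> mirabolic v n" and x: "x \<in> carrier_vec n"
  shows "sup_abs v (n - 1) (x \<bullet>\<^sub>r k) = sup_abs v (n - 1) x"
    and "v ((x \<bullet>\<^sub>r k) $ (n - 1) - x $ (n - 1)) \<le> sup_abs v (n - 1) x"
proof -
  obtain a b where ab: "k \<in> GL v n" "a \<in> GL v (n - 1)" "b \<in> carrier_mat (n - 1) 1"
    "elements_mat b \<subseteq> integers v" "k = four_block_mat a b (0\<^sub>m 1 (n - 1)) (1\<^sub>m 1)"
    using k by (auto simp: mirabolic_def)
  have ac: "a \<in> carrier_mat (n - 1) (n - 1)"
    using GL_D(1)[OF ab(2)] .
  have split: "{..<n} = insert (n - 1) {..<n - 1}"
    using n_pos by auto
  have sum_split: "(\<Sum>i<n. g i) = g (n - 1) + (\<Sum>i<n - 1. g i)" for g :: "nat \<Rightarrow> 'a"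
    unfolding split by (simp del: One_nat_def)
  let ?h = "vec (n - 1) (\<lambda>i. x $ i)"
  have head: "(x \<bullet>\<^sub>r k) $ j = (?h \<bullet>\<^sub>r a) $ j" if "j < n - 1" for j
    using that ab(3,5) ac x n_ge_2 GL_D(1)[OF ab(1)]
    by (simp add: row_mult_index[of _ n n] row_mult_index[of _ "n - 1" "n - 1"] sum_split del: One_nat_def)
  have "sup_abs v (n - 1) (x \<bullet>\<^sub>r k) = sup_abs v (n - 1) (?h \<bullet>\<^sub>r a)"
    unfolding sup_abs_def using head by (intro arg_cong[of _ _ Max] image_cong) auto
  also have "\<dots> = sup_abs v (n - 1) ?h"
    using ab(2) n_ge_2 by (intro sup_abs_row_mult_GL) auto
  also have "\<dots> = sup_abs v (n - 1) x"
    unfolding sup_abs_def by (intro arg_cong[of _ _ Max] image_cong) auto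
  finally show "sup_abs v (n - 1) (x \<bullet>\<^sub>r k) = sup_abs v (n - 1) x" .
  have "(x \<bullet>\<^sub>r k) $ (n - 1) - x $ (n - 1) = (\<Sum>i<n - 1. x $ i * b $$ (i, 0))"
    using ab(3,5) ac x n_ge_2 GL_D(1)[OF ab(1)]
    by (simp add: row_mult_index[of _ n n] sum_split del: One_nat_def)
  also have "v \<dots> \<le> sup_abs v (n - 1) x * 1"
  proof (rule abs_sum_le)
    fix i assume i: "i \<in> {..<n - 1}"
    then have "v (b $$ (i, 0)) \<le> 1"
      using ab(3,4) elements_mat_integers_iff[of b "n - 1" 1] by auto
    then have "v (x $ i) * v (b $$ (i, 0)) \<le> sup_abs v (n - 1) x * 1"
      using i abs_le_sup_abs nonneg sup_abs_nonneg n_ge_2 by (intro mult_mono) auto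
    then show "v (x $ i * b $$ (i, 0)) \<le> sup_abs v (n - 1) x * 1"
      by (simp add: mult)
  qed (use sup_abs_nonneg n_ge_2 in simp)
  finally show "v ((x \<bullet>\<^sub>r k) $ (n - 1) - x $ (n - 1)) \<le> sup_abs v (n - 1) x"
    by simp
qed

section \<open>The explicit function is zonal\<close>

lemma shell_level: "cond < m \<Longrightarrow> cond \<le> m - 1"
  by simp

text \<open>The coefficient stays a parameter: with \<open>zonal_coeff\<close> this is the zonal
  function of level m, and with a = 0 at level m - 1 it is the test function that determines the
  coefficient.\<close>

definition zonal_function :: "nat \<Rightarrow> complex \<Rightarrow> 'a vec \<Rightarrow> complex" where
  "zonal_function m a = (\<lambda>x \<in> unit_sphere v n.
     if x \<in> head_ball m then cv (x $ (n - 1))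
     else if cond < m \<and> x \<in> head_ball (m - 1) then a * cv (x $ (n - 1)) else 0)"

lemma zonal_function_level:
  assumes m: "cond \<le> m"
  shows "zonal_function m a \<in> level_space v w n chi m"
  unfolding level_space_iff
proof (intro conjI ballI allI impI)
  show "zonal_function m a \<in> extensional (unit_sphere v n)"
    by (simp add: zonal_function_def)
next
  fix x y assume x: "x \<in> unit_sphere v n" and y: "y \<in> sphere_ball m x"
  have y': "y \<in> unit_sphere v n"
    using y by (simp add: sphere_ball_def)
  have "v (y $ (n - 1) - x $ (n - 1)) \<le> v w ^ m"
    using y n_pos by (simp add: sphere_ball_def)
  then have "v (y $ (n - 1) - x $ (n - 1)) \<le> v w ^ cond"
    using powers_antimono[OF m] by linarith
  then have "cv (y $ (n - 1)) = cv (x $ (n - 1))" if "x \<in> head_ball j" "cond \<le> j" for j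
    using cv_close head_ball_unit[OF that] by blast
  then have "cv (y $ (n - 1)) = cv (x $ (n - 1))"
    if "x \<in> head_ball m \<or> cond < m \<and> x \<in> head_ball (m - 1)"
    using that m shell_level by blast
  then show "zonal_function m a y = zonal_function m a x"
    using x y' head_ball_sphere_ball[OF x y, of m] head_ball_sphere_ball[OF x y, of "m - 1"]
    by (auto simp: zonal_function_def)
next
  fix b x assume b: "v b = 1" and x: "x \<in> unit_sphere v n"
  have "(b \<cdot>\<^sub>v x) $ (n - 1) = b * x $ (n - 1)"
    using x n_pos by (auto simp: unit_sphere_iff dest: carrier_vecD)
  moreover have "cv (b * x $ (n - 1)) = chi b * cv (x $ (n - 1))" if "x \<in> head_ball j" "cond \<le> j" for j
    using cv_mult head_ball_unit[OF that] b by blast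
  ultimately have "cv ((b \<cdot>\<^sub>v x) $ (n - 1)) = chi b * cv (x $ (n - 1))"
    if "x \<in> head_ball m \<or> cond < m \<and> x \<in> head_ball (m - 1)"
    using that m shell_level by metis
  then show "zonal_function m a (b \<cdot>\<^sub>v x) = chi b * zonal_function m a x"
    using x b unit_sphere_smult[OF x b] head_ball_smult[OF x b]
    by (auto simp: zonal_function_def)
qed

lemma zonal_function_mirabolic:
  assumes m: "cond \<le> m" and x: "x \<in> unit_sphere v n" and k: "k \<in> mirabolic v n"
  shows "zonal_function m a (x \<bullet>\<^sub>r k) = zonal_function m a x"
proof -
  have xc: "x \<in> carrier_vec n"
    using x by (simp add: unit_sphere_iff)
  have y: "x \<bullet>\<^sub>r k \<in> unit_sphere v n"
    using sphere_mult_GL[OF x] k by (auto simp: mirabolic_def)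
  have hb: "x \<bullet>\<^sub>r k \<in> head_ball j \<longleftrightarrow> x \<in> head_ball j" for j
    using x y mirabolic_action(1)[OF k xc] by (simp add: head_ball_def)
  have "cv ((x \<bullet>\<^sub>r k) $ (n - 1)) = cv (x $ (n - 1))" if "x \<in> head_ball j" "cond \<le> j" for j
  proof (rule cv_close)
    show "cond = 0 \<or> v (x $ (n - 1)) = 1"
      using head_ball_unit[OF that] .
    show "v ((x \<bullet>\<^sub>r k) $ (n - 1) - x $ (n - 1)) \<le> v w ^ cond"
      using mirabolic_action(2)[OF k xc] that powers_antimono[OF that(2)] by (simp add: head_ball_def)
  qed
  then have "cv ((x \<bullet>\<^sub>r k) $ (n - 1)) = cv (x $ (n - 1))"
    if "x \<in> head_ball m \<or> cond < m \<and> x \<in> head_ball (m - 1)"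
    using that m shell_level by blast
  then show ?thesis
    using x y hb by (auto simp: zonal_function_def)
qed

lemma e_last_head_ball: "e_last n \<in> head_ball m"
  using n_ge_2 e_last_in_sphere by (auto simp: head_ball_def sup_abs_le_iff e_last_def less_imp_le)

lemma zonal_zonal_function:
  assumes m: "cond \<le> m"
  shows "zonal v w n \<mu> chi m (zonal_function m (of_real (zonal_coeff (residue_order v) n m)))"
    (is "zonal v w n \<mu> chi m ?P")
proof -
  let ?a = "complex_of_real (zonal_coeff (residue_order v) n m)"
  have inner: "sphere_inner n \<mu> ?P g = 0"
    if "cond < m" and g: "g \<in> level_space v w n chi (m - 1)" for g
  proof -
    let ?c = "cnj (g (e_last n))"
    have "?P x * cnj (g x) =
        (if x \<in> head_ball m then ?c else if x \<in> head_ball (m - 1) then ?a * ?c else 0)"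
      if x: "x \<in> unit_sphere v n" for x
    proof -
      \<comment> \<open>On this set g is a multiple of the same character, and chi is unimodular, so
        the phases cancel and only the constant \<open>?c\<close> remains.\<close>
      have "cv (x $ (n - 1)) * cnj (g x) = ?c" if "x \<in> head_ball (m - 1)"
        using level_space_head_ball[OF g _ that] cv_cnj[OF head_ball_unit[OF that]] \<open>cond < m\<close>
        by simp
      then show ?thesis
        using x \<open>cond < m\<close> head_ball_antimono[of "m - 1" m] by (auto simp: zonal_function_def)
    qed
    then have "sphere_inner n \<mu> ?P g = ?c * of_real (sphere_measure (head_ball m)) +
        ?a * ?c * of_real (sphere_measure (head_ball (m - 1)) - sphere_measure (head_ball m))"
      unfolding sphere_inner_def by (rule integral_head_balls)
    also have "\<dots> = ?c * (of_real (sphere_measure (head_ball m)) +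
        ?a * of_real (sphere_measure (head_ball (m - 1)) - sphere_measure (head_ball m)))"
      by (simp only: distrib_left mult_ac)
    also have "\<dots> = 0"
      using zonal_coeff_unique[of m ?a] that(1) by simp
    finally show ?thesis .
  qed
  have "?P (e_last n) = 1"
    using e_last_in_sphere e_last_head_ball n_pos
    by (simp add: zonal_function_def e_last_def cv_one)
  then show ?thesis
    unfolding zonal_def harmonic_space_def
    using zonal_function_level[OF m] zonal_function_mirabolic[OF m] inner m by auto
qed

text \<open>The maximum is the absolute value of a coordinate, and no absolute value lies strictly
  between consecutive powers of q.\<close>

lemma sup_abs_discrete:
  assumes "v w ^ Suc j < sup_abs v (n - 1) x"
  shows "v w ^ j \<le> sup_abs v (n - 1) x"
proof -
  obtain i where "v (x $ i) = sup_abs v (n - 1) x"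
    using sup_abs_attained[of "n - 1"] n_ge_2 by (metis Suc_1 Suc_le_lessD zero_less_diff)
  then show ?thesis
    using abs_less_power_imp_le[of "x $ i" j] assms by force
qed

section \<open>Uniqueness of the zonal function\<close>

context
  fixes m :: nat and P :: "'a vec \<Rightarrow> complex"
  assumes m: "cond \<le> m" and P: "zonal v w n \<mu> chi m P"
begin

lemma zonal_level: "P \<in> level_space v w n chi m"
  using P by (auto simp: zonal_def harmonic_space_def split: if_splits)

lemma zonal_last: "P (e_last n) = 1"
  using P by (simp add: zonal_def)

lemma zonal_orthogonal: "cond < m \<Longrightarrow> g \<in> level_space v w n chi (m - 1) \<Longrightarrow> sphere_inner n \<mu> P g = 0"
  using P by (auto simp: zonal_def harmonic_space_def split: if_splits)

lemma zonal_mirabolic_orbit: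
  assumes "x \<in> unit_sphere v n" "y \<in> unit_sphere v n"
    and "sup_abs v (n - 1) y = sup_abs v (n - 1) x" "0 < sup_abs v (n - 1) x"
    and "v (y $ (n - 1) - x $ (n - 1)) \<le> sup_abs v (n - 1) x"
  shows "P y = P x"
proof -
  obtain k where "k \<in> mirabolic v n" "x \<bullet>\<^sub>r k = y"
    using mirabolic_orbit[OF n_ge_2, of x y "sup_abs v (n - 1) x"] assms by (auto simp: unit_sphere_iff)
  then show ?thesis
    using P assms(1) by (auto simp: zonal_def)
qed

lemma zonal_vanishes_at_conductor:
  assumes "m = cond" "x \<in> unit_sphere v n" "x \<notin> head_ball m"
  shows "P x = 0"
proof -
  have "m \<noteq> 0"
    using assms head_ball_0 by metis
  then obtain j where j: "m = Suc j"
    by (cases m) auto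
  obtain u where u: "v u = 1" "v (u - 1) \<le> v w ^ j" "chi u \<noteq> 1"
    using chi_below_conductor[of j] j assms(1) by (auto simp: unit_filtration_iff)
  have "v w ^ Suc j < sup_abs v (n - 1) x"
    using assms j by (simp add: head_ball_def)
  then have s: "v w ^ j \<le> sup_abs v (n - 1) x"
    by (rule sup_abs_discrete)
  have xc: "x \<in> carrier_vec n"
    using assms by (simp add: unit_sphere_iff)
  \<comment> \<open>Scaling by u preserves M and moves the last coordinate by at most q^(-j), which
    is at most M. So u x lies in the mirabolic orbit of x, and equivariance gives P x = chi(u) P
    x.\<close>
  have "(u \<cdot>\<^sub>v x) $ (n - 1) - x $ (n - 1) = (u - 1) * x $ (n - 1)"
    using xc n_pos by (simp add: algebra_simps)
  moreover have "v (u - 1) * v (x $ (n - 1)) \<le> v w ^ j * 1"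
    using u unit_sphere_abs_le[OF assms(2)] n_pos nonneg by (intro mult_mono) (auto simp: less_imp_le)
  ultimately have "v ((u \<cdot>\<^sub>v x) $ (n - 1) - x $ (n - 1)) \<le> sup_abs v (n - 1) x"
    using s by (simp add: mult)
  moreover have "0 < sup_abs v (n - 1) x"
    using s powers_pos[of j] by linarith
  ultimately have "P (u \<cdot>\<^sub>v x) = P x"
    using xc u(1) assms(2) by (intro zonal_mirabolic_orbit unit_sphere_smult sup_abs_smult) auto
  then show ?thesis
    using level_spaceD(2)[OF zonal_level u(1) assms(2)] u(3) by simp
qed

text \<open>The test function is \<open>P\<close> itself, cut off to the complement of \<open>head_ball (m - 1)\<close>: there
  invariance under the mirabolic subgroup makes \<open>P\<close> invariant under congruences modulo one power
  less.\<close>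

lemma zonal_vanishes:
  assumes "cond < m" "x \<in> unit_sphere v n" "x \<notin> head_ball (m - 1)"
  shows "P x = 0"
proof -
  let ?g = "\<lambda>x \<in> unit_sphere v n. if x \<in> head_ball (m - 1) then 0 else P x"
  have "?g \<in> level_space v w n chi (m - 1)"
    unfolding level_space_iff
  proof (intro conjI ballI allI impI)
    fix x y assume x: "x \<in> unit_sphere v n" and y: "y \<in> sphere_ball (m - 1) x"
    have y': "y \<in> unit_sphere v n"
      using y by (simp add: sphere_ball_def)
    have hb: "y \<in> head_ball (m - 1) \<longleftrightarrow> x \<in> head_ball (m - 1)"
      using head_ball_sphere_ball[OF x y] by simp
    have "P y = P x" if "x \<notin> head_ball (m - 1)"
    proof (rule zonal_mirabolic_orbit[OF x y'])
      \<comment> \<open>Since M exceeds q^(1-m) here, a congruence modulo p^(m-1) preserves M and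
        moves the last coordinate by less than M.\<close>
      have s: "v w ^ (m - 1) < sup_abs v (n - 1) x"
        using that x by (simp add: head_ball_def)
      have close: "v (x $ i - y $ i) \<le> v w ^ (m - 1)" if "i < n" for i
        using y that abs_diff_commute[of "x $ i" "y $ i"] by (simp add: sphere_ball_def)
      show "sup_abs v (n - 1) y = sup_abs v (n - 1) x"
        using s close n_ge_2 by (intro sup_abs_cong(2)[of _ _ _ "v w ^ (m - 1)"]) auto
      show "0 < sup_abs v (n - 1) x"
        using s powers_pos[of "m - 1"] by linarith
      show "v (y $ (n - 1) - x $ (n - 1)) \<le> sup_abs v (n - 1) x"
        using s close[of "n - 1"] n_pos abs_diff_commute[of "x $ (n - 1)"] by simp
    qed
    then show "?g y = ?g x"
      using x y' hb by simp
  next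
    fix a x assume "v a = 1" "x \<in> unit_sphere v n"
    then show "?g (a \<cdot>\<^sub>v x) = chi a * ?g x"
      using unit_sphere_smult[of x n a] head_ball_smult[of x a] level_spaceD(2)[OF zonal_level, of a x]
      by simp
  qed simp
  then have 0: "sphere_inner n \<mu> P ?g = 0"
    using zonal_orthogonal assms(1) by blast
  \<comment> \<open>Pairing P with its own cutoff integrates |P|^2 over the complement. The
    integrand is nonnegative and constant on cosets of level m, so a zero integral forces it to
    vanish at every point.\<close>
  define G where "G k = (if e_last n \<bullet>\<^sub>r k \<in> head_ball (m - 1) then 0
    else (cmod (P (e_last n \<bullet>\<^sub>r k)))\<^sup>2)" for k
  have "sphere_inner n \<mu> P ?g = (\<integral>k. complex_of_real (G k) \<partial>\<mu>)"
    unfolding sphere_inner_def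
    by (intro Bochner_Integration.integral_cong refl)
      (auto simp: space_haar G_def sphere_mult_GL[OF e_last_in_sphere] complex_norm_square
        simp del: of_real_power)
  then have int: "(\<integral>k. complex_of_real (G k) \<partial>\<mu>) = 0"
    using 0 by simp
  obtain k where k: "k \<in> GL v n" "e_last n \<bullet>\<^sub>r k = x"
    using sphere_transitive[OF e_last_in_sphere assms(2)] by blast
  have "G k = 0"
  proof (rule integral_nonneg_eq_zero[OF _ _ int k(1)])
    fix k k' assume k: "k \<in> GL v n" "k' \<in> coset m k"
    then have "e_last n \<bullet>\<^sub>r k \<in> unit_sphere v n" "e_last n \<bullet>\<^sub>r k' \<in> sphere_ball m (e_last n \<bullet>\<^sub>r k)"
      using sphere_mult_GL[OF e_last_in_sphere] sphere_mult_coset[OF e_last_in_sphere] by auto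
    then show "G k' = G k"
      using head_ball_sphere_ball[of _ _ m "m - 1"] level_spaceD(1)[OF zonal_level]
      by (simp add: G_def)
  qed (simp add: G_def)
  then show ?thesis
    using k assms(3) by (simp add: G_def)
qed

text \<open>The point x0 represents the shell M = q^(1-m). If m > 1, the last coordinate of x is a
  unit; dividing by it gives last coordinate 1, and the result lies in the mirabolic orbit of x0. If
  m = 1, it may be a non-unit, but M = 1 absorbs any difference in the last coordinate, and chi is
  trivial.\<close>

lemma zonal_on_shell:
  assumes "cond < m"
  shows "\<exists>a. \<forall>x \<in> head_ball (m - 1) - head_ball m. P x = a * cv (x $ (n - 1))"
proof -
  define x0 :: "'a vec" where "x0 = vec n (\<lambda>i. if i = n - 1 then 1 else w ^ (m - 1))"
  have x0i: "x0 $ i = w ^ (m - 1)" if "i < n - 1" for i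
    using that by (simp add: x0_def)
  have x0n: "x0 $ (n - 1) = 1"
    using n_pos by (simp add: x0_def)
  have head0: "sup_abs v (n - 1) x0 = v w ^ (m - 1)"
  proof (rule antisym)
    show "sup_abs v (n - 1) x0 \<le> v w ^ (m - 1)"
      using n_ge_2 x0i by (simp add: sup_abs_le_iff abs_power)
    show "v w ^ (m - 1) \<le> sup_abs v (n - 1) x0"
      using n_ge_2 x0i[of 0] abs_le_sup_abs[of 0 "n - 1" x0] by (simp add: abs_power)
  qed
  have x0: "x0 \<in> unit_sphere v n"
    unfolding unit_sphere_iff
  proof
    have "v (x0 $ i) \<le> 1" if "i < n" for i
      using that by (simp add: x0_def abs_one abs_power)
    then show "sup_abs v n x0 = 1"
      using abs_le_sup_abs[of "n - 1" n x0] n_pos x0n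
      by (intro antisym) (auto simp: sup_abs_le_iff abs_one)
  qed (simp add: x0_def)
  have "P x = P x0 * cv (x $ (n - 1))" if x: "x \<in> head_ball (m - 1) - head_ball m" for x
  proof -
    have xS: "x \<in> unit_sphere v n"
      using x head_ball_sphere by blast
    have "v w ^ Suc (m - 1) < sup_abs v (n - 1) x"
      using x xS assms by (simp add: head_ball_def not_le)
    then have head: "sup_abs v (n - 1) x = v w ^ (m - 1)"
      using sup_abs_discrete[of "m - 1" x] x by (simp add: head_ball_def)
    show ?thesis
    proof (cases "m = 1")
      case True
      have "v (x $ (n - 1) - x0 $ (n - 1)) \<le> 1"
        using abs_diff_le[of "x $ (n - 1)" 1] unit_sphere_abs_le[OF xS, of "n - 1"] n_pos x0n
        by (simp add: abs_one)
      then have "P x = P x0"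
        using True head head0 by (intro zonal_mirabolic_orbit x0 xS) auto
      then show ?thesis
        using True assms by (simp add: cv_eq)
    next
      case False
      let ?t = "x $ (n - 1)"
      have t: "v ?t = 1"
        using head_ball_last[of x "m - 1"] x False assms by simp
      then have t0: "?t \<noteq> 0"
        by auto
      have ti: "v (1 / ?t) = 1"
        using t by (simp add: abs_divide abs_one)
      let ?y = "(1 / ?t) \<cdot>\<^sub>v x"
      have xc: "x \<in> carrier_vec n"
        using xS by (simp add: unit_sphere_iff)
      have y: "?y \<in> unit_sphere v n"
        using unit_sphere_smult[OF xS ti] .
      have "sup_abs v (n - 1) ?y = v w ^ (m - 1)"
        using xc ti head by (subst sup_abs_smult) auto
      moreover have "?y $ (n - 1) = 1"
        using xc n_pos t0 by simp
      ultimately have "P ?y = P x0"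
        using head0 x0n by (intro zonal_mirabolic_orbit x0 y) (auto simp: less_imp_le)
      moreover have "x = ?t \<cdot>\<^sub>v ?y"
        using t0 xc by (intro eq_vecI) auto
      then have "P x = chi ?t * P ?y"
        using level_spaceD(2)[OF zonal_level t y] by simp
      moreover have "chi ?t = cv ?t"
        using t chi_eq_one by (simp add: cv_eq)
      ultimately show ?thesis
        by simp
    qed
  qed
  then show ?thesis
    by blast
qed

lemma zonal_eq_zonal_function:
  "P = zonal_function m (of_real (zonal_coeff (residue_order v) n m))"
proof -
  let ?\<alpha> = "complex_of_real (zonal_coeff (residue_order v) n m)"
  have ball: "P x = cv (x $ (n - 1))" if "x \<in> head_ball m" for x
    using level_space_head_ball[OF zonal_level m that] zonal_last by simp
  have shell: "P x = ?\<alpha> * cv (x $ (n - 1))"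
    if c: "cond < m" and x: "x \<in> head_ball (m - 1)" "x \<notin> head_ball m" for x
  proof -
    obtain a where a: "\<And>x. x \<in> head_ball (m - 1) - head_ball m \<Longrightarrow> P x = a * cv (x $ (n - 1))"
      using zonal_on_shell[OF c] by blast
    \<comment> \<open>At level m - 1 the coefficient 0 leaves chi(x_n) on
      \<open>head_ball (m - 1)\<close> and zero outside it.\<close>
    let ?Q = "zonal_function (m - 1) 0"
    have "P x * cnj (?Q x) =
        (if x \<in> head_ball m then 1 else if x \<in> head_ball (m - 1) then a else 0)"
      if xS: "x \<in> unit_sphere v n" for x
    proof -
      have "cv (x $ (n - 1)) * cnj (cv (x $ (n - 1))) = 1" if "x \<in> head_ball (m - 1)"
        using cv_cnj[OF head_ball_unit[OF that]] c by simp
      then show ?thesis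
        using xS ball[of x] a[of x] head_ball_antimono[of "m - 1" m]
        by (auto simp: zonal_function_def)
    qed
    then have "sphere_inner n \<mu> P ?Q = 1 * of_real (sphere_measure (head_ball m)) +
        a * of_real (sphere_measure (head_ball (m - 1)) - sphere_measure (head_ball m))"
      unfolding sphere_inner_def by (rule integral_head_balls)
    moreover have "sphere_inner n \<mu> P ?Q = 0"
      using c by (intro zonal_orthogonal zonal_function_level) auto
    ultimately have "a = ?\<alpha>"
      using zonal_coeff_unique[of m a] c by simp
    then show ?thesis
      using a x by simp
  qed
  show ?thesis
  proof (rule extensionalityI[of _ "unit_sphere v n"])
    show "P \<in> extensional (unit_sphere v n)"
      using zonal_level by (simp add: level_space_iff)
    fix x assume x: "x \<in> unit_sphere v n"
    show "P x = zonal_function m ?\<alpha> x"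
      using x ball[of x] shell[of x] zonal_vanishes_at_conductor[of x] zonal_vanishes[of x] le_neq_implies_less[OF m]
      by (auto simp: zonal_function_def)
  qed (simp add: zonal_function_def)
qed

end

text \<open>Discreteness of the absolute value turns membership in the larger ball but not in the
  smaller one into the equality M = q^(1-m). The integer exponent -m + 1 matches the natural number
  m - 1 only for m > 0, which \<open>cond < m\<close> ensures.\<close>

lemma zonal_function_formula:
  assumes m: "cond \<le> m" and x: "x \<in> unit_sphere v n"
  shows "zonal_function m a x =
    (if sup_abs v (n - 1) x \<le> real (residue_order v) powi (- int m) then cv (x $ (n - 1))
     else if cond < m \<and> sup_abs v (n - 1) x = real (residue_order v) powi (- int m + 1)
       then a * cv (x $ (n - 1)) else 0)"
proof -
  have pow: "real (residue_order v) powi (- int j) = v w ^ j" for j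
    by (simp add: abs_uniformiser power_int_minus power_one_over inverse_eq_divide)
  have "- int m + 1 = - int (m - 1)" if "cond < m"
    using that by simp
  then have pow1: "real (residue_order v) powi (- int m + 1) = v w ^ (m - 1)" if "cond < m"
    using that pow by metis
  have "x \<in> head_ball (m - 1) \<longleftrightarrow> sup_abs v (n - 1) x = v w ^ (m - 1)"
    if "cond < m" "\<not> sup_abs v (n - 1) x \<le> v w ^ m"
    using sup_abs_discrete[of "m - 1" x] that x by (auto simp: head_ball_def)
  then show ?thesis
    unfolding pow using x pow1 by (auto simp: zonal_function_def head_ball_def)
qed

text \<open>The identity x h = e_n says that e_n - x_n y is a combination of the first n - 1 rows of
  h with coefficients x_i, hence has entries of size at most the maximum M of x. If M < 1, then x_n
  is a unit, and dividing by it bounds the first coordinates of y; otherwise M = 1 bounds them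
  trivially.\<close>

lemma last_row_inverse:
  assumes kh: "k \<in> GL v n" "h \<in> GL v n" "k * h = 1\<^sub>m n"
  defines "x \<equiv> e_last n \<bullet>\<^sub>r k" and "y \<equiv> e_last n \<bullet>\<^sub>r h"
  shows "sup_abs v (n - 1) y \<le> sup_abs v (n - 1) x"
    and "v (x $ (n - 1) * y $ (n - 1) - 1) \<le> sup_abs v (n - 1) x"
proof -
  have c: "k \<in> carrier_mat n n" "h \<in> carrier_mat n n" "(e_last n :: 'a vec) \<in> carrier_vec n"
    using kh GL_D(1) by (auto simp: e_last_def)
  have xS: "x \<in> unit_sphere v n"
    using sphere_mult_GL[OF e_last_in_sphere kh(1)] by (simp add: x_def)
  then have xc: "x \<in> carrier_vec n"
    by (simp add: unit_sphere_iff)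
  have xh: "x \<bullet>\<^sub>r h = e_last n"
    using row_mult_assoc[OF c(1,2,3)] row_mult_one[OF c(3)] unfolding x_def kh(3) by simp
  have split: "{..<n} = insert (n - 1) {..<n - 1}"
    using n_pos by auto
  have sum_split: "(\<Sum>i<n. g i) = g (n - 1) + (\<Sum>i<n - 1. g i)" for g :: "nat \<Rightarrow> 'a"
    unfolding split by (simp del: One_nat_def)
  have y_eq: "y $ j = h $$ (n - 1, j)" if "j < n" for j
    using that c n_pos unfolding y_def
    by (simp add: row_mult_index[of _ n n] sum_split e_last_def del: One_nat_def)
  have close: "v (x $ (n - 1) * y $ j - e_last n $ j) \<le> sup_abs v (n - 1) x" if j: "j < n" for j
  proof -
    have "e_last n $ j = x $ (n - 1) * y $ j + (\<Sum>i<n - 1. x $ i * h $$ (i, j))"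
      using row_mult_index[OF c(2) xc j] unfolding xh sum_split y_eq[OF j] .
    then have "x $ (n - 1) * y $ j - e_last n $ j = - (\<Sum>i<n - 1. x $ i * h $$ (i, j))"
      by simp
    also have "v \<dots> \<le> sup_abs v (n - 1) x * 1"
      unfolding abs_minus
    proof (rule abs_sum_le)
      fix i assume i: "i \<in> {..<n - 1}"
      then have "v (x $ i) * v (h $$ (i, j)) \<le> sup_abs v (n - 1) x * 1"
        using j abs_le_sup_abs nonneg sup_abs_nonneg n_ge_2 GL_D(2)[OF kh(2)]
        by (intro mult_mono) auto
      then show "v (x $ i * h $$ (i, j)) \<le> sup_abs v (n - 1) x * 1"
        by (simp add: mult)
    qed (use sup_abs_nonneg n_ge_2 in simp)
    finally show ?thesis
      by simp
  qed
  show "v (x $ (n - 1) * y $ (n - 1) - 1) \<le> sup_abs v (n - 1) x"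
    using close[of "n - 1"] n_pos by (simp add: e_last_def)
  have yS: "y \<in> unit_sphere v n"
    using sphere_mult_GL[OF e_last_in_sphere kh(2)] by (simp add: y_def)
  show "sup_abs v (n - 1) y \<le> sup_abs v (n - 1) x"
  proof (cases "sup_abs v (n - 1) x < 1")
    case True
    have "x \<in> head_ball 1"
    proof -
      have "v (x $ i) \<le> v w" if "i < n - 1" for i
        using abs_le_sup_abs[OF that, of x] True by (intro abs_less_one_imp_le) simp
      then show ?thesis
        using xS n_ge_2 by (simp add: head_ball_def sup_abs_le_iff)
    qed
    then have "v (x $ (n - 1)) = 1"
      using head_ball_last by simp
    then have "v (y $ j) \<le> sup_abs v (n - 1) x" if "j < n - 1" for j
      using close[of j] that by (simp add: e_last_def mult)
    then show ?thesis
      using n_ge_2 by (simp add: sup_abs_le_iff)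
  next
    case False
    have "sup_abs v (n - 1) y \<le> 1"
      using unit_sphere_abs_le[OF yS] n_ge_2 by (simp add: sup_abs_le_iff)
    then show ?thesis
      using False by simp
  qed
qed

text \<open>Applied to k and to its inverse, the comparison of last rows x and y gives equal M. On
  the support, for nontrivial chi, it also gives x_n y_n congruent to 1 modulo p^cond, so chi(x_n)
  is the inverse of chi(y_n), which is its conjugate. The coefficient is real, so conjugation fixes
  it.\<close>

lemma zonal_function_inverse:
  assumes m: "cond \<le> m" and k: "k \<in> GL v n"
  shows "zonal_function m (of_real a) (e_last n \<bullet>\<^sub>r k)
    = cnj (zonal_function m (of_real a) (e_last n \<bullet>\<^sub>r inv\<^bsub>mat_monoid v n\<^esub> k))"
proof -
  let ?h = "inv\<^bsub>mat_monoid v n\<^esub> k"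
  let ?x = "e_last n \<bullet>\<^sub>r k" and ?y = "e_last n \<bullet>\<^sub>r ?h"
  have S: "?x \<in> unit_sphere v n" "?y \<in> unit_sphere v n"
    using sphere_mult_GL[OF e_last_in_sphere] k GL_inv(1)[OF k] by auto
  have "sup_abs v (n - 1) ?x = sup_abs v (n - 1) ?y"
    using last_row_inverse(1)[OF k GL_inv(1)[OF k] GL_inv(2)[OF k]]
      last_row_inverse(1)[OF GL_inv(1)[OF k] k GL_inv(3)[OF k]] by simp
  then have hb: "?x \<in> head_ball j \<longleftrightarrow> ?y \<in> head_ball j" for j
    using S by (simp add: head_ball_def)
  have cv: "cv (?x $ (n - 1)) = cnj (cv (?y $ (n - 1)))" if x: "?x \<in> head_ball j" and j: "cond \<le> j" for j
  proof (cases "cond = 0")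
    case False
    let ?s = "?x $ (n - 1)" and ?t = "?y $ (n - 1)"
    have st: "v ?s = 1" "v ?t = 1"
      using head_ball_unit[OF x j] head_ball_unit[of ?y j] x hb j False by auto
    have "v (?s * ?t - 1) \<le> v w ^ cond"
      using last_row_inverse(2)[OF k GL_inv(1)[OF k] GL_inv(2)[OF k]] x powers_antimono[OF j]
      by (simp add: head_ball_def)
    then have "chi (?s * ?t) = 1"
      using st by (intro chi_conductor) (simp add: unit_filtration_iff mult)
    then have "chi ?s * chi ?t = 1"
      using chi_mult[OF st] by simp
    moreover have "chi ?t * cnj (chi ?t) = 1"
      using cv_cnj[of ?t] st False by (simp add: cv_eq)
    ultimately have "chi ?s = cnj (chi ?t)"
      by (metis mult.assoc mult.left_neutral mult.right_neutral)
    then show ?thesis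
      using False by (simp add: cv_eq)
  qed (simp add: cv_eq)
  show ?thesis
    using S hb cv[OF _ m] cv[OF _ shell_level] by (auto simp: zonal_function_def)
qed

end

theorem proposition3p4:
  fixes v :: "'a::field \<Rightarrow> real" and w :: 'a and n m :: nat
    and \<mu> :: "'a mat measure" and chi :: "'a \<Rightarrow> complex"
  assumes "nonarch_local_field v w"
    and "n \<ge> 2"
    and "haar_probability v n \<mu>"
    and "unit_character v chi"
    and "m \<ge> conductor v w chi"
  shows "(\<exists>!P. zonal v w n \<mu> chi m P) \<and>
    (\<forall>P. zonal v w n \<mu> chi m P \<longrightarrow>
      (\<forall>x \<in> unit_sphere v n.
        let q = residue_order v; M = Max ((\<lambda>i. v (x $ i)) ` {..<n - 1}) in
        P x =
          (if M \<le> real q powi (- int m) then char_value v chi (x $ (n - 1))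
           else if m > conductor v w chi \<and> M = real q powi (- int m + 1)
             then of_real (zonal_coeff q n m) * char_value v chi (x $ (n - 1))
           else 0)) \<and>
      (\<forall>k \<in> GL v n. P (e_last n \<bullet>\<^sub>r k) = cnj (P (e_last n \<bullet>\<^sub>r inv\<^bsub>mat_monoid v n\<^esub> k))))"
proof -
  interpret nonarch_local_field v w
    by fact
  interpret haar_character v w n \<mu> chi
    by unfold_locales (use assms in auto)
  let ?P = "zonal_function m (of_real (zonal_coeff (residue_order v) n m))"
  have eq: "P = ?P" if "zonal v w n \<mu> chi m P" for P
    using zonal_eq_zonal_function[OF assms(5) that] .
  moreover have "zonal v w n \<mu> chi m ?P"
    using zonal_zonal_function[OF assms(5)] .
  ultimately have "\<exists>!P. zonal v w n \<mu> chi m P"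
    by metis
  then show ?thesis
    using eq zonal_function_formula[OF assms(5)] zonal_function_inverse[OF assms(5)]
    unfolding sup_abs_def Let_def by blast
qed

end
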